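(* Let $\kappa \in \mathbb{Z}_p \setminus \mathbb{Z}_{\geq 0}$. Then \[ S(b',\varepsilon;0) = R(b';0) \oplus \partial_\kappa S(b',\varepsilon;\varepsilon). \] Hence $H^1_\kappa(S(b',\varepsilon)) := S(b',\varepsilon)/\partial_\kappa S(b',\varepsilon) \cong R(b')$.
   Context: Fix a prime $p \geq 5$, $\pi \in \overline{\mathbb{Q}}_p$ with $\pi^{p-1} = -p$, and $\Omega := \mathbb{Q}_p(\pi)$. Let $b, b'$ be real numbers with $(p-1)/p \geq b > 1/(p-1)$ and $b \geq b'$, and set $\varepsilon := b - 1/(p-1)$. For $m \geq 0$ let $\kappa^{\underline m} := \kappa(\kappa-1)\cdots(\kappa-m+1)$ ($\kappa^{\underline 0} := 1$), and in $\Omega[[t,w]]$ put $w^{(m)} := \kappa^{\underline m} w^m$. For $\rho \in \mathbb{R}$ let $S(b',\varepsilon;\rho)$ be the set of series $\sum_{n,m\geq 0} A(n,m) t^n w^{(m)}$ with $A(n,m) \in \Omega$ and $\mathrm{ord}_p A(n,m) \geq 2b'n + \varepsilon m + \rho$, and $S(b',\varepsilon) := \bigcup_\rho S(b',\varepsilon;\rho)$. Let $R(b';\rho) \subset S(b',\varepsilon;\rho)$ be the subset of series $\sum_{n\geq 0} A(n) t^n$ involving only $w^{(0)} = 1$, and $R(b') := \bigcup_\rho R(b';\rho)$. The operator $\partial_\kappa$ on $S(b',\varepsilon)$ is the $\Omega$-linear, termwise-extended map with $\partial_\kappa(t^n w^{(m)}) := n t^n w^{(m)} + t^n w^{(m+1)}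 + m(\kappa - m + 1)\pi^2 t^{n+1} w^{(m-1)}$ (last term absent when $m=0$). *)

theory Defs
  imports
    "HOL-Algebra.Algebraic_Closure_Type"
    "HOL-Algebra.Generated_Fields"
    "HOL-Computational_Algebra.Fraction_Field"
    "HOL-Computational_Algebra.Formal_Power_Series"
    "HOL-Library.Extended_Real"
    "HOL-Library.FuncSet"
    "Berlekamp_Zassenhaus.Finite_Field"
begin

text \<open>
  The prime \<open>p\<close> is the cardinality of a type \<open>'p\<close> of class \<open>prime_card\<close>. The ring of \<open>p\<close>-adic
  integers is the inverse limit of the rings of integers modulo \<open>p ^ n\<close>, an element being given by
  its sequence of reduced residues.
\<close>

typedef 'p padic_int =
  "{f :: nat \<Rightarrow> int. \<forall>n. f (Suc n) mod int CARD('p::prime_card) ^ n = f n}"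
  by (rule exI[of _ "\<lambda>_. 0"]) simp

setup_lifting type_definition_padic_int

lemma mod_pow_Suc_mod: "(a::int) mod q ^ Suc n mod q ^ n = a mod q ^ n"
  by (rule mod_mod_cancel) simp

lemma padic_seq_mod:
  fixes f :: "nat \<Rightarrow> int"
  assumes "\<forall>n. f (Suc n) mod q ^ n = f n"
  shows "f n mod q ^ n = f n"
  using assms by (metis mod_mod_trivial)

lemma padic_seq_mod_le:
  fixes f :: "nat \<Rightarrow> int"
  assumes "\<forall>n. f (Suc n) mod q ^ n = f n"
  shows "f (n + k) mod q ^ n = f n"
proof (induction k)
  case 0
  show ?case using padic_seq_mod[OF assms] by simp
next
  case (Suc k)
  have "f (n + Suc k) mod q ^ n = f (Suc (n + k)) mod q ^ (n + k) mod q ^ n"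
    by (simp add: mod_mod_cancel le_imp_power_dvd)
  with assms Suc show ?case by simp
qed

instantiation padic_int :: (prime_card) comm_ring_1
begin

lift_definition zero_padic_int :: "'a padic_int" is "\<lambda>_. 0" by simp

lift_definition one_padic_int :: "'a padic_int" is "\<lambda>n. 1 mod int CARD('a) ^ n"
  by (simp only: mod_pow_Suc_mod simp_thms)

lift_definition plus_padic_int :: "'a padic_int \<Rightarrow> 'a padic_int \<Rightarrow> 'a padic_int"
  is "\<lambda>f g n. (f n + g n) mod int CARD('a) ^ n"
  by (simp only: mod_pow_Suc_mod) (metis mod_add_eq)

lift_definition minus_padic_int :: "'a padic_int \<Rightarrow> 'a padic_int \<Rightarrow> 'a padic_int"
  is "\<lambda>f g n. (f n - g n) mod int CARD('a) ^ n"
  by (simp only: mod_pow_Suc_mod) (metis mod_diff_eq)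

lift_definition uminus_padic_int :: "'a padic_int \<Rightarrow> 'a padic_int"
  is "\<lambda>f n. (- f n) mod int CARD('a) ^ n"
  by (simp only: mod_pow_Suc_mod) (metis mod_minus_eq)

lift_definition times_padic_int :: "'a padic_int \<Rightarrow> 'a padic_int \<Rightarrow> 'a padic_int"
  is "\<lambda>f g n. (f n * g n) mod int CARD('a) ^ n"
  by (simp only: mod_pow_Suc_mod) (metis mod_mult_eq)

instance
proof
  fix a b c :: "'a padic_int"
  show "a * b * c = a * (b * c)"
    by transfer (simp add: fun_eq_iff mod_simps mult.assoc)
  show "a * b = b * a"
    by transfer (simp add: mult.commute)
  show "1 * a = a"
    by transfer (simp add: fun_eq_iff mod_simps padic_seq_mod)
  show "(a + b) * c = a * c + b * c"
    by transfer (simp add: fun_eq_iff mod_simps distrib_right)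
  show "a + b + c = a + (b + c)"
    by transfer (simp add: fun_eq_iff mod_simps add.assoc)
  show "a + b = b + a"
    by transfer (simp add: add.commute)
  show "0 + a = a"
    by transfer (simp add: fun_eq_iff padic_seq_mod)
  show "- a + a = 0"
    by transfer (simp add: fun_eq_iff mod_simps)
  show "a - b = a + - b"
    by transfer (simp add: fun_eq_iff mod_simps)
  show "(0::'a padic_int) \<noteq> 1"
  proof (transfer, rule notI)
    assume "(\<lambda>_. 0) = (\<lambda>n. 1 mod int CARD('a) ^ n)"
    from fun_cong[OF this, of 1] prime_gt_1_int[OF prime_card_int, where 'a1 = 'a]
    show False by simp
  qed
qed

end

instance padic_int :: (prime_card) idom
proof
  fix a b :: "'a padic_int"
  assume "a \<noteq> 0" "b \<noteq> 0"
  then show "a * b \<noteq> 0"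
  proof transfer
    fix f g :: "nat \<Rightarrow> int"
    let ?q = "int CARD('a)"
    assume f: "\<forall>n. f (Suc n) mod ?q ^ n = f n" and g: "\<forall>n. g (Suc n) mod ?q ^ n = g n"
    assume "f \<noteq> (\<lambda>_. 0)" "g \<noteq> (\<lambda>_. 0)"
    then obtain i j where ij: "f i \<noteq> 0" "g j \<noteq> 0" by (auto simp: fun_eq_iff)
    have nf: "\<not> ?q ^ i dvd f (i + j)"
      using padic_seq_mod_le[OF f, of i j] ij by (auto simp: dvd_eq_mod_eq_0)
    have ng: "\<not> ?q ^ j dvd g (i + j)"
      using padic_seq_mod_le[OF g, of j i] ij by (auto simp: dvd_eq_mod_eq_0 add.commute)
    have "i > 0" using nf by (cases i) auto
    have q: "prime_elem ?q" using prime_card_int by blast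
    have "\<not> ?q ^ (i + j) dvd f (i + j) * g (i + j)"
    proof
      assume "?q ^ (i + j) dvd f (i + j) * g (i + j)"
      then have "?q ^ (i + j - 1) dvd f (i + j) * g (i + j)"
        by (meson dvd_trans le_imp_power_dvd diff_le_self)
      with prime_elem_power_dvd_cases[OF this _ q, of i j] \<open>i > 0\<close> nf ng show False by simp
    qed
    then show "(\<lambda>n. f n * g n mod ?q ^ n) \<noteq> (\<lambda>_. 0)"
      by (auto simp: fun_eq_iff dvd_eq_mod_eq_0 intro!: exI[of _ "i + j"])
  qed
qed

type_synonym 'p qp = "'p padic_int fract"
type_synonym 'p qp_bar = "'p qp alg_closure"

definition Zp :: "'p::prime_card qp_bar set" where
  "Zp = range (\<lambda>z. to_ac (Fract z 1))"

text \<open>\<open>ord\<^sub>p\<close> of a nonzero \<open>x = p\<^sup>k u\<close>, with \<open>u\<close> a unit of the ring of \<open>p\<close>-adic integers, is \<open>k\<close>.\<close>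

definition ord_qp :: "'p::prime_card qp \<Rightarrow> ereal" where
  "ord_qp x = (if x = 0 then \<infinity> else
     ereal (of_int (THE k::int. \<exists>u::'p padic_int. u dvd 1 \<and> x = of_nat CARD('p) powi k * Fract u 1)))"

definition Omega :: "'p::prime_card qp_bar \<Rightarrow> 'p qp_bar set" where
  "Omega \<pi> = generate_field ring_of_type_algebra (insert \<pi> (range to_ac))"

definition valuation_on :: "'a::field set \<Rightarrow> ('a \<Rightarrow> ereal) \<Rightarrow> bool" where
  "valuation_on K v \<longleftrightarrow>
     (\<forall>x\<in>K. v x \<noteq> -\<infinity> \<and> (v x = \<infinity> \<longleftrightarrow> x = 0)) \<and>
     (\<forall>x\<in>K. \<forall>y\<in>K. v (x * y) = v x + v y \<and> min (v x) (v y) \<le> v (x + y))"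

text \<open>
  The unique extension of \<open>ord\<^sub>p\<close> to a valuation of a field \<open>K\<close> between the \<open>p\<close>-adic numbers and
  their algebraic closure; \<open>extensional\<close> only fixes the irrelevant values outside \<open>K\<close>.
\<close>

definition ord_ext :: "'p::prime_card qp_bar set \<Rightarrow> 'p qp_bar \<Rightarrow> ereal" where
  "ord_ext K = (THE v. v \<in> extensional K \<and> valuation_on K v \<and> (\<forall>x. v (to_ac x) = ord_qp x))"

definition Omega_int :: "'p::prime_card qp_bar \<Rightarrow> 'p qp_bar set" where
  "Omega_int \<pi> = {x \<in> Omega \<pi>. 0 \<le> ord_ext (Omega \<pi>) x}"

text \<open>
  A power series in \<open>t\<close> and \<open>w\<close> is a power series in \<open>t\<close> whose coefficients are power series in
  \<open>w\<close>: the outer \<open>fps_X\<close> is \<open>t\<close> and \<open>fps_const fps_X\<close> is \<open>w\<close>.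
\<close>

definition scale :: "'a::field \<Rightarrow> 'a fps fps \<Rightarrow> 'a fps fps" where
  "scale c f = fps_const (fps_const c) * f"

definition falling :: "'a::field \<Rightarrow> nat \<Rightarrow> 'a" where
  "falling \<kappa> m = (\<Prod>i<m. \<kappa> - of_nat i)"

definition wfall :: "'a::field \<Rightarrow> nat \<Rightarrow> 'a fps fps" where
  "wfall \<kappa> m = scale (falling \<kappa> m) (fps_const fps_X ^ m)"

text \<open>The series \<open>\<Sum>\<^sub>n\<^sub>,\<^sub>m A(n,m) t\<^sup>n w\<^sup>(\<^sup>m\<^sup>)\<close>.\<close>

definition wseries :: "'a::field \<Rightarrow> (nat \<Rightarrow> nat \<Rightarrow> 'a) \<Rightarrow> 'a fps fps" where
  "wseries \<kappa> A = Abs_fps (\<lambda>n. Abs_fps (\<lambda>m. A n m * falling \<kappa> m))"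

definition S_space ::
  "'p::prime_card qp_bar \<Rightarrow> 'p qp_bar \<Rightarrow> real \<Rightarrow> real \<Rightarrow> real \<Rightarrow> 'p qp_bar fps fps set" where
  "S_space \<pi> \<kappa> b' \<epsilon> \<rho> = {wseries \<kappa> A | A. \<forall>n m. A n m \<in> Omega \<pi> \<and>
     ereal (2 * b' * real n + \<epsilon> * real m + \<rho>) \<le> ord_ext (Omega \<pi>) (A n m)}"

definition S_union ::
  "'p::prime_card qp_bar \<Rightarrow> 'p qp_bar \<Rightarrow> real \<Rightarrow> real \<Rightarrow> 'p qp_bar fps fps set" where
  "S_union \<pi> \<kappa> b' \<epsilon> = (\<Union>\<rho>. S_space \<pi> \<kappa> b' \<epsilon> \<rho>)"

definition R_space :: "'p::prime_card qp_bar \<Rightarrow> real \<Rightarrow> real \<Rightarrow> 'p qp_bar fps fps set" where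
  "R_space \<pi> b' \<rho> = {Abs_fps (\<lambda>n. fps_const (a n)) | a. \<forall>n. a n \<in> Omega \<pi> \<and>
     ereal (2 * b' * real n + \<rho>) \<le> ord_ext (Omega \<pi>) (a n)}"

definition R_union :: "'p::prime_card qp_bar \<Rightarrow> real \<Rightarrow> 'p qp_bar fps fps set" where
  "R_union \<pi> b' = (\<Union>\<rho>. R_space \<pi> b' \<rho>)"

definition del_mono :: "'a::field \<Rightarrow> 'a \<Rightarrow> nat \<Rightarrow> nat \<Rightarrow> 'a fps fps" where
  "del_mono \<pi> \<kappa> n m =
     scale (of_nat n) (fps_X ^ n * wfall \<kappa> m) + fps_X ^ n * wfall \<kappa> (m + 1) +
     (if m = 0 then 0 else
        scale (of_nat m * (\<kappa> - of_nat m + 1) * \<pi>\<^sup>2) (fps_X ^ (n + 1) * wfall \<kappa> (m - 1)))"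

text \<open>
  The coefficient \<open>A(n,m)\<close> of \<open>t\<^sup>n w\<^sup>(\<^sup>m\<^sup>)\<close>; meaningful because \<open>falling \<kappa> m\<close> is nonzero when
  \<open>\<kappa>\<close> is not a natural number.
\<close>

definition wcoeff :: "'a::field \<Rightarrow> 'a fps fps \<Rightarrow> nat \<Rightarrow> nat \<Rightarrow> 'a" where
  "wcoeff \<kappa> f n m = fps_nth (fps_nth f n) m / falling \<kappa> m"

text \<open>
  Termwise extension of \<open>del_mono\<close>: the monomial \<open>t\<^sup>n w\<^sup>k\<close> occurs in \<open>del_mono \<pi> \<kappa> i j\<close> only if
  \<open>i \<le> n\<close> and \<open>j \<le> k + 1\<close>.
\<close>

definition del :: "'a::field \<Rightarrow> 'a \<Rightarrow> 'a fps fps \<Rightarrow> 'a fps fps" where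
  "del \<pi> \<kappa> f = Abs_fps (\<lambda>n. Abs_fps (\<lambda>k.
     \<Sum>i\<le>n. \<Sum>j\<le>k + 1. wcoeff \<kappa> f i j * fps_nth (fps_nth (del_mono \<pi> \<kappa> i j) n) k))"

definition is_submodule :: "'a::field set \<Rightarrow> 'a fps fps set \<Rightarrow> bool" where
  "is_submodule K M \<longleftrightarrow> 0 \<in> M \<and> (\<forall>f\<in>M. \<forall>g\<in>M. f + g \<in> M) \<and> (\<forall>c\<in>K. \<forall>f\<in>M. scale c f \<in> M)"

definition internal_direct_sum ::
  "'a::field set \<Rightarrow> 'a fps fps set \<Rightarrow> 'a fps fps set \<Rightarrow> 'a fps fps set \<Rightarrow> bool" where
  "internal_direct_sum K M A B \<longleftrightarrow>
     is_submodule K M \<and> is_submodule K A \<and> is_submodule K B \<and>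
     M = {f + g | f g. f \<in> A \<and> g \<in> B} \<and> A \<inter> B = {0}"

definition add_coset :: "'a::field fps fps set \<Rightarrow> 'a fps fps \<Rightarrow> 'a fps fps set" where
  "add_coset N f = {f + g | g. g \<in> N}"

definition quotient_space :: "'a::field fps fps set \<Rightarrow> 'a fps fps set \<Rightarrow> 'a fps fps set set" where
  "quotient_space M N = add_coset N ` M"

definition coset_add ::
  "'a::field fps fps set \<Rightarrow> 'a fps fps set \<Rightarrow> 'a fps fps set" where
  "coset_add C D = {f + g | f g. f \<in> C \<and> g \<in> D}"

definition coset_scale ::
  "'a::field fps fps set \<Rightarrow> 'a \<Rightarrow> 'a fps fps set \<Rightarrow> 'a fps fps set" where
  "coset_scale N c C = {scale c f + g | f g. f \<in> C \<and> g \<in> N}"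

text \<open>\<open>\<phi>\<close> is a \<open>K\<close>-linear isomorphism from \<open>V\<close> onto the quotient of \<open>M\<close> by its submodule \<open>N\<close>.\<close>

definition quotient_iso :: "'a::field set \<Rightarrow> 'a fps fps set \<Rightarrow> 'a fps fps set \<Rightarrow>
    'a fps fps set \<Rightarrow> ('a fps fps \<Rightarrow> 'a fps fps set) \<Rightarrow> bool" where
  "quotient_iso K M N V \<phi> \<longleftrightarrow>
     is_submodule K M \<and> is_submodule K N \<and> N \<subseteq> M \<and> is_submodule K V \<and>
     bij_betw \<phi> V (quotient_space M N) \<and>
     (\<forall>f\<in>V. \<forall>g\<in>V. \<phi> (f + g) = coset_add (\<phi> f) (\<phi> g)) \<and>
     (\<forall>c\<in>K. \<forall>f\<in>V. \<phi> (scale c f) = coset_scale N c (\<phi> f))"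

end

theory Submission
  imports Defs "HOL-Number_Theory.Cong"
begin

text \<open>
  On coefficients, \<open>\<Sum> B(n,m) t\<^sup>n w\<^sup>(\<^sup>m\<^sup>) - \<partial>\<^sub>\<kappa> \<Sum> A(n,m) t\<^sup>n w\<^sup>(\<^sup>m\<^sup>)\<close> involves only \<open>w\<^sup>(\<^sup>0\<^sup>)\<close> iff
  \<open>A(n,m) + n A(n,m+1) = B(n,m+1) - (m+2) (\<kappa>-m-1) \<pi>\<^sup>2 A(n-1,m+2)\<close> for all \<open>n\<close>, \<open>m\<close>. By recursion on
  \<open>n\<close> the right-hand side is a known \<open>C(n,m)\<close>, and the unique solution of bounded growth is the
  convergent series \<open>A(n,m) = \<Sum>\<^sub>k (-n)\<^sup>k C(n,m+k)\<close>; the orders match because \<open>\<pi>\<^sup>2\<close> has order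
  \<open>2/(p-1)\<close> and \<open>b' \<le> b = \<epsilon> + 1/(p-1)\<close>.

  That \<open>ord\<^sub>p\<close> extends uniquely to \<open>\<Omega>\<close>, and that \<open>\<Omega>\<close> is complete, is seen in the basis
  \<open>1, \<pi>, \<dots>, \<pi>\<^sup>p\<^sup>-\<^sup>2\<close>: the orders of the terms \<open>a\<^sub>i \<pi>\<^sup>i\<close> differ modulo 1, so the valuation of a sum is
  the minimum of the valuations of its terms.
\<close>

section \<open>The ring of p-adic integers\<close>

text \<open>The equation determines \<open>A(n,m)\<close> from \<open>A(n,m+1)\<close>, one step
  further out, so no finite recursion in \<open>m\<close> has a starting point. Hence the infinite
  series, the need for completeness, and the role of \<open>\<epsilon> > 0\<close>: the integers
  \<open>(-n)^k\<close> need not tend to 0, and the decay comes from \<open>\<epsilon> * k\<close>.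
  Uniqueness has the same source: a homogeneous row satisfies
  \<open>A(n,m) = (-n)^k A(n,m+k)\<close> for every \<open>k\<close>, so its order is arbitrarily
  large. The shift from 0 to \<open>\<epsilon>\<close> in the theorem is the price of multiplying by
  \<open>w\<close> once. The term with \<open>\<pi>\<close> squared gains twice the order of
  \<open>\<pi>\<close>, loses \<open>2 b'\<close> through \<open>t\<close>, loses
  \<open>\<epsilon>\<close> through \<open>w\<close> and may lose \<open>\<epsilon>\<close> more by
  that shift. This is the balance expressed by \<open>b' \<le> b\<close>. As \<open>ord_ext\<close>
  is a definite description, no estimate in \<open>\<Omega>\<close> is available before existence
  and uniqueness of the extension are settled. The same comparison of orders modulo 1 also yields
  irreducibility of the Eisenstein polynomial. The decomposition is proved for every
  \<open>\<rho>\<close>, so that unions over \<open>\<rho>\<close> give the quotient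
  statement.\<close>

lemma card_gt_1: "int CARD('p::prime_card) > 1"
  using prime_gt_1_int[OF prime_card_int, where 'a1 = 'p] .

lemma Rep_padic_int_Suc_mod:
  "Rep_padic_int (x::'p::prime_card padic_int) (Suc n) mod int CARD('p) ^ n = Rep_padic_int x n"
  using Rep_padic_int[of x] by blast

lemma Rep_padic_int_mod_le:
  "Rep_padic_int (x::'p::prime_card padic_int) (n + k) mod int CARD('p) ^ n = Rep_padic_int x n"
  using padic_seq_mod_le[of "Rep_padic_int x" "int CARD('p)" n k] Rep_padic_int[of x] by blast

lemma Rep_padic_int_0 [simp]: "Rep_padic_int x 0 = 0"
  using Rep_padic_int_mod_le[of x 0 0] by simp

lemma Rep_padic_int_of_nat:
  "Rep_padic_int (of_nat m :: 'p::prime_card padic_int) n = int m mod int CARD('p) ^ n"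
  by (induction m) (simp_all add: zero_padic_int.rep_eq one_padic_int.rep_eq
      plus_padic_int.rep_eq mod_simps)

text \<open>A nonzero residue modulo \<open>p\<close> makes the residue at level \<open>n\<close>
  invertible modulo \<open>p ^ n\<close>. Inverses chosen level by level are automatically
  compatible, because an inverse modulo \<open>p ^ n\<close> is unique.\<close>

lemma padic_int_dvd_1_iff: "(x::'p::prime_card padic_int) dvd 1 \<longleftrightarrow> Rep_padic_int x 1 \<noteq> 0"
proof
  assume "x dvd 1"
  then obtain y where y: "1 = x * y" by (rule dvdE)
  have "Rep_padic_int (1::'p padic_int) 1 = (Rep_padic_int x 1 * Rep_padic_int y 1) mod int CARD('p)"
    by (subst y) (simp only: times_padic_int.rep_eq power_one_right)
  then show "Rep_padic_int x 1 \<noteq> 0"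
    using card_gt_1[where 'p='p] by (auto simp: one_padic_int.rep_eq)
next
  define q where "q = int CARD('p)"
  define f where "f = Rep_padic_int x"
  assume "Rep_padic_int x 1 \<noteq> 0"
  then have f1: "f 1 \<noteq> 0" by (simp add: f_def)
  have q: "prime q" unfolding q_def by (rule prime_card_int)
  have f: "f (Suc n) mod q ^ n = f n" for n
    unfolding f_def q_def by (rule Rep_padic_int_Suc_mod)
  have cop: "coprime (f n) (q ^ n)" for n
  proof (cases n)
    case (Suc m)
    have "f (1 + m) mod q ^ 1 = f 1"
      unfolding f_def q_def by (rule Rep_padic_int_mod_le)
    then have "\<not> q dvd f n" using f1 Suc by (auto simp: dvd_eq_mod_eq_0)
    then show ?thesis using q by (simp add: coprime_commute prime_imp_coprime)
  qed simp
  have "\<exists>g. [f n * g = 1] (mod q ^ n)" for n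
    using cong_solve_coprime_int[OF cop] .
  then obtain g0 where g0: "\<And>n. [f n * g0 n = 1] (mod q ^ n)" by metis
  define g where "g n = g0 n mod q ^ n" for n
  have g: "[f n * g n = 1] (mod q ^ n)" for n
    using g0[of n] by (simp add: g_def cong_def mod_simps)
  have gS: "g (Suc n) mod q ^ n = g n" for n
  proof -
    have "[f (Suc n) * g (Suc n) = 1] (mod q ^ n)"
      using g[of "Suc n"] by (rule cong_dvd_modulus) simp
    moreover have "[f (Suc n) = f n] (mod q ^ n)"
      using f[of n] by (metis cong_def mod_mod_trivial)
    ultimately have "[f n * g (Suc n) = 1] (mod q ^ n)"
      by (metis cong_scalar_right cong_sym cong_trans)
    with g[of n] have "[f n * g (Suc n) = f n * g n] (mod q ^ n)"
      by (metis cong_sym cong_trans)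
    then have "[g (Suc n) = g n] (mod q ^ n)"
      using cop cong_mult_lcancel by blast
    then show ?thesis by (simp add: cong_def g_def)
  qed
  have "x * Abs_padic_int g = 1"
  proof -
    have "Rep_padic_int (Abs_padic_int g :: 'p padic_int) = g"
      using gS by (intro Abs_padic_int_inverse) (simp add: q_def)
    then show ?thesis
      using g by (simp add: Rep_padic_int_inject[symmetric] fun_eq_iff times_padic_int.rep_eq
          one_padic_int.rep_eq cong_def f_def q_def)
  qed
  then show "x dvd 1" by (metis dvdI)
qed

text \<open>Division by \<open>p ^ k\<close> costs \<open>k\<close> digits, so level
  \<open>n\<close> of the quotient is read off from level \<open>n + k\<close> of \<open>x\<close>.
  The formula for the residues of \<open>u\<close> is exported so that \<open>u\<close> can be
  tested for being a unit.\<close>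

lemma padic_int_eq_power_mult:
  assumes "Rep_padic_int (x::'p::prime_card padic_int) k = 0"
  obtains u where "x = of_nat CARD('p) ^ k * u"
    and "\<And>n. Rep_padic_int u n = Rep_padic_int x (n + k) div int CARD('p) ^ k"
proof -
  define q where "q = int CARD('p)"
  define f where "f = Rep_padic_int x"
  define g where "g n = f (n + k) div q ^ k" for n
  have q0: "q > 0" using card_gt_1[where 'p='p] by (simp add: q_def)
  have f: "f (Suc n) mod q ^ n = f n" for n
    unfolding f_def q_def by (rule Rep_padic_int_Suc_mod)
  have f': "f (n + l) mod q ^ n = f n" for n l
    unfolding f_def q_def by (rule Rep_padic_int_mod_le)
  have dvd: "q ^ k dvd f (n + k)" for n
    using f'[of k n] assms by (simp add: f_def dvd_eq_mod_eq_0 add.commute)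
  have gk: "q ^ k * g n = f (n + k)" for n
    using dvd by (simp add: g_def)
  have gS: "g (Suc n) mod q ^ n = g n" for n
  proof -
    have "f (Suc n + k) mod (q ^ k * q ^ n) = q ^ k * (g (Suc n) mod q ^ n) + f (Suc n + k) mod q ^ k"
      unfolding g_def using q0 by (simp add: zmod_zmult2_eq)
    also have "f (Suc n + k) mod (q ^ k * q ^ n) = f (n + k)"
      using f[of "n + k"] by (simp add: power_add mult.commute)
    also have "f (Suc n + k) mod q ^ k = 0" using dvd[of "Suc n"] by simp
    finally show ?thesis using gk[of n] q0 by simp
  qed
  define u :: "'p padic_int" where "u = Abs_padic_int g"
  have u: "Rep_padic_int u = g"
    unfolding u_def using gS by (intro Abs_padic_int_inverse) (simp add: q_def)
  have "Rep_padic_int (of_nat CARD('p) ^ k * u) n = f n" for n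
  proof -
    have "Rep_padic_int (of_nat (CARD('p) ^ k) * u) n = (q ^ k * g n) mod q ^ n"
      unfolding times_padic_int.rep_eq Rep_padic_int_of_nat u by (simp add: mod_simps q_def)
    then show ?thesis using gk f'[of n k] by (simp add: of_nat_power)
  qed
  then have "x = of_nat CARD('p) ^ k * u"
    by (simp add: Rep_padic_int_inject[symmetric] fun_eq_iff f_def)
  then show thesis using that[of u] u by (simp add: g_def f_def q_def)
qed

text \<open>Level 0 always vanishes, so the first nonzero level is some \<open>Suc k\<close>. Then
  \<open>x\<close> is divisible by \<open>p ^ k\<close> and the quotient has a nonzero residue
  modulo \<open>p\<close>.\<close>

lemma padic_int_prime_power_unit:
  assumes "x \<noteq> (0::'p::prime_card padic_int)"
  obtains k u where "u dvd 1" and "x = of_nat CARD('p) ^ k * u"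
proof -
  have "\<exists>n. Rep_padic_int x n \<noteq> 0"
    using assms by (auto simp: Rep_padic_int_inject[symmetric] fun_eq_iff zero_padic_int.rep_eq)
  then have l: "Rep_padic_int x (LEAST n. Rep_padic_int x n \<noteq> 0) \<noteq> 0"
    by (rule LeastI_ex)
  then obtain k where k: "(LEAST n. Rep_padic_int x n \<noteq> 0) = Suc k"
    by (cases "LEAST n. Rep_padic_int x n \<noteq> 0") auto
  have z: "Rep_padic_int x k = 0"
    using not_less_Least[of k "\<lambda>n. Rep_padic_int x n \<noteq> 0"] k by auto
  obtain u where u: "x = of_nat CARD('p) ^ k * u"
    and r: "\<And>n. Rep_padic_int u n = Rep_padic_int x (n + k) div int CARD('p) ^ k"
    using padic_int_eq_power_mult[OF z] by blast
  have "int CARD('p) ^ k dvd Rep_padic_int x (k + 1)"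
    using Rep_padic_int_mod_le[of x k 1] z by (simp add: dvd_eq_mod_eq_0)
  then have "Rep_padic_int u 1 \<noteq> 0"
    using l k by (auto simp: r elim!: dvdE)
  then show thesis using that u padic_int_dvd_1_iff by blast
qed

lemma of_nat_CARD_padic_int_neq_0: "(of_nat CARD('p) :: 'p::prime_card padic_int) \<noteq> 0"
proof
  assume "(of_nat CARD('p) :: 'p padic_int) = 0"
  \<comment> \<open>Level 2 is the first one that sees \<open>p\<close>: at level 1 its residue is
    0.\<close>
  then have "Rep_padic_int (of_nat CARD('p) :: 'p padic_int) 2 = 0"
    by (simp add: zero_padic_int.rep_eq)
  moreover have "int CARD('p) * 1 < int CARD('p) * int CARD('p)"
    using card_gt_1[where 'p='p] by (intro mult_strict_left_mono) auto
  ultimately show False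
    unfolding Rep_padic_int_of_nat using card_gt_1[where 'p='p] by (simp add: power2_eq_square)
qed

lemma padic_int_not_CARD_dvd_unit:
  "(u::'p::prime_card padic_int) dvd 1 \<Longrightarrow> \<not> of_nat CARD('p) dvd u"
  by (auto simp: padic_int_dvd_1_iff times_padic_int.rep_eq Rep_padic_int_of_nat elim!: dvdE)

text \<open>At each level the residues of \<open>y n\<close> are eventually constant. These eventual
  values are compatible because any two levels can be compared at a common large
  \<open>n\<close>.\<close>

lemma padic_int_Cauchy_convergent:
  fixes y :: "nat \<Rightarrow> 'p::prime_card padic_int"
  assumes "\<And>m. \<forall>\<^sub>F n in sequentially. of_nat CARD('p) ^ m dvd y (Suc n) - y n"
  shows "\<exists>s. \<forall>m. \<forall>\<^sub>F n in sequentially. of_nat CARD('p) ^ m dvd s - y n"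
proof -
  define q where "q = int CARD('p)"
  have "\<exists>c. \<forall>\<^sub>F n in sequentially. Rep_padic_int (y n) m = c" for m
  proof -
    obtain N where N: "\<And>n. n \<ge> N \<Longrightarrow> of_nat CARD('p) ^ m dvd y (Suc n) - y n"
      using assms[of m] by (auto simp: eventually_sequentially)
    have step: "Rep_padic_int (y (Suc n)) m = Rep_padic_int (y n) m" if "n \<ge> N" for n
    proof -
      obtain z where "y (Suc n) - y n = of_nat CARD('p) ^ m * z" using N[OF \<open>n \<ge> N\<close>] by (elim dvdE)
      then have "y (Suc n) = y n + of_nat (CARD('p) ^ m) * z" by (simp add: algebra_simps)
      moreover have "Rep_padic_int (of_nat (CARD('p) ^ m) :: 'p padic_int) m = 0"
        unfolding Rep_padic_int_of_nat by simp
      ultimately have "Rep_padic_int (y (Suc n)) m = Rep_padic_int (y n) m mod int CARD('p) ^ m"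
        by (simp only: plus_padic_int.rep_eq times_padic_int.rep_eq mult_zero_left mod_0 add_0_right)
      then show ?thesis
        using Rep_padic_int_mod_le[of "y n" m 0] by simp
    qed
    have "Rep_padic_int (y n) m = Rep_padic_int (y N) m" if "n \<ge> N" for n
      using that by (induction n rule: dec_induct) (simp_all add: step)
    then show ?thesis by (auto simp: eventually_sequentially)
  qed
  then obtain c where c: "\<And>m. \<forall>\<^sub>F n in sequentially. Rep_padic_int (y n) m = c m" by metis
  have "c (Suc m) mod q ^ m = c m" for m
  proof -
    have "\<forall>\<^sub>F n in sequentially. c (Suc m) mod q ^ m = c m"
      using c[of m] c[of "Suc m"]
      by eventually_elim (metis Rep_padic_int_Suc_mod q_def)
    then show ?thesis by simp
  qed
  then have r: "Rep_padic_int (Abs_padic_int c :: 'p padic_int) = c"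
    by (intro Abs_padic_int_inverse) (simp add: q_def)
  show ?thesis
  proof (intro exI allI)
    fix m
    show "\<forall>\<^sub>F n in sequentially. of_nat CARD('p) ^ m dvd Abs_padic_int c - y n"
      using c[of m]
    proof eventually_elim
      case (elim n)
      then have "Rep_padic_int (Abs_padic_int c - y n) m = 0"
        by (simp add: minus_padic_int.rep_eq r)
      then obtain u where "Abs_padic_int c - y n = of_nat CARD('p) ^ m * u"
        using padic_int_eq_power_mult[where x = "Abs_padic_int c - y n" and k = m] by metis
      then show ?case by simp
    qed
  qed
qed

section \<open>The field of p-adic numbers\<close>

text \<open>A set inside an ambient field instead of a type, because \<open>Omega\<close> is a
  subset of the algebraic closure and its valuation is meaningful only there. The p-adic numbers are
  the instance \<open>K = UNIV\<close>.\<close>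

locale valued_subring =
  fixes K :: "'a::field set" and v :: "'a \<Rightarrow> ereal"
  assumes zero_closed [simp]: "0 \<in> K" and one_closed [simp]: "1 \<in> K"
    and add_closed [simp]: "x \<in> K \<Longrightarrow> y \<in> K \<Longrightarrow> x + y \<in> K"
    and mult_closed [simp]: "x \<in> K \<Longrightarrow> y \<in> K \<Longrightarrow> x * y \<in> K"
    and minus_closed [simp]: "x \<in> K \<Longrightarrow> - x \<in> K"
    and valuation: "valuation_on K v"
begin

lemma diff_closed [simp]: "x \<in> K \<Longrightarrow> y \<in> K \<Longrightarrow> x - y \<in> K"
  using add_closed[of x "- y"] by simp

lemma power_closed [simp]: "x \<in> K \<Longrightarrow> x ^ n \<in> K"
  by (induction n) auto

lemma of_nat_closed [simp]: "of_nat n \<in> K"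
  by (induction n) auto

lemma sum_closed [simp]: "(\<And>i. i \<in> I \<Longrightarrow> f i \<in> K) \<Longrightarrow> sum f I \<in> K"
  by (induction I rule: infinite_finite_induct) auto

lemma v_eq_infinity_iff [simp]: "x \<in> K \<Longrightarrow> v x = \<infinity> \<longleftrightarrow> x = 0"
  and v_neq_minus_infinity [simp]: "x \<in> K \<Longrightarrow> v x \<noteq> -\<infinity>"
  and v_mult: "x \<in> K \<Longrightarrow> y \<in> K \<Longrightarrow> v (x * y) = v x + v y"
  and v_add: "x \<in> K \<Longrightarrow> y \<in> K \<Longrightarrow> min (v x) (v y) \<le> v (x + y)"
  using valuation unfolding valuation_on_def by blast+

lemma v_0 [simp]: "v 0 = \<infinity>"
  by simp

lemma v_finite: "x \<in> K \<Longrightarrow> x \<noteq> 0 \<Longrightarrow> \<exists>r. v x = ereal r"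
  by (cases "v x") (use v_eq_infinity_iff[of x] v_neq_minus_infinity[of x] in auto)

lemma v_1 [simp]: "v 1 = 0"
proof -
  obtain r where r: "v 1 = ereal r" using v_finite[of 1] by auto
  have "v 1 = v 1 + v 1" using v_mult[of 1 1] by simp
  then show ?thesis using r by (simp add: zero_ereal_def)
qed

lemma v_minus [simp]: "x \<in> K \<Longrightarrow> v (- x) = v x"
proof -
  assume x: "x \<in> K"
  obtain r where r: "v (- 1) = ereal r" using v_finite[of "- 1"] by auto
  have "v 1 = v (- 1) + v (- 1)" using v_mult[of "- 1" "- 1"] by simp
  then have "v (- 1) = 0" using r by (simp add: zero_ereal_def)
  then show "v (- x) = v x" using v_mult[of "- 1" x] x by simp
qed

lemma v_add_ge: "x \<in> K \<Longrightarrow> y \<in> K \<Longrightarrow> r \<le> v x \<Longrightarrow> r \<le> v y \<Longrightarrow> r \<le> v (x + y)"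
  using v_add[of x y] by (meson min.boundedI order_trans)

lemma v_diff_ge: "x \<in> K \<Longrightarrow> y \<in> K \<Longrightarrow> r \<le> v x \<Longrightarrow> r \<le> v y \<Longrightarrow> r \<le> v (x - y)"
  using v_add_ge[of x "- y" r] by simp

lemma v_sum_ge: "(\<And>i. i \<in> I \<Longrightarrow> f i \<in> K \<and> r \<le> v (f i)) \<Longrightarrow> r \<le> v (sum f I)"
  by (induction I rule: infinite_finite_induct) (auto intro!: v_add_ge)

text \<open>The hypothesis \<open>r < \<infinity>\<close> accounts for the empty sum, whose
  valuation is infinite.\<close>

lemma v_sum_gt:
  assumes "\<And>i. i \<in> I \<Longrightarrow> f i \<in> K \<and> r < v (f i)" and "r < \<infinity>"
  shows "r < v (sum f I)"
  using assms
proof (induction I rule: infinite_finite_induct)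
  case (insert i I)
  then have "r < min (v (f i)) (v (sum f I))" by simp
  also have "\<dots> \<le> v (f i + sum f I)" using insert by (intro v_add) auto
  finally show ?case using insert by simp
qed auto

text \<open>For the upper bound, apply the ultrametric inequality to \<open>x = (x + y) - y\<close>:
  the term \<open>y\<close> cannot attain the minimum.\<close>

lemma v_add_eq:
  assumes "x \<in> K" "y \<in> K" "v x < v y" shows "v (x + y) = v x"
proof (rule antisym)
  show "v x \<le> v (x + y)" using v_add[of x y] assms by (simp add: min.absorb1)
  have "min (v (x + y)) (v y) \<le> v x"
    using v_add[of "x + y" "- y"] assms by simp
  then show "v (x + y) \<le> v x" using assms by (auto simp: min_def split: if_splits)
qed

lemma v_sum_eq_dominant:
  assumes "finite I" "i \<in> I" "\<And>j. j \<in> I \<Longrightarrow> f j \<in> K" "\<And>j. j \<in> I \<Longrightarrow> j \<noteq> i \<Longrightarrow> v (f i) < v (f j)"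
    and "f i \<noteq> 0"
  shows "v (sum f I) = v (f i)"
proof -
  have "v (f i) < v (sum f (I - {i}))"
    using assms by (intro v_sum_gt) (auto simp: less_top[symmetric] top_ereal_def)
  then show ?thesis
    using assms by (subst sum.remove[of I i]) (auto intro!: v_add_eq sum_closed)
qed

lemma v_of_nat_ge_0 [simp]: "0 \<le> v (of_nat n)"
  by (induction n) (auto intro!: v_add_ge)

lemma v_mult_ge:
  assumes "x \<in> K" "y \<in> K" "ereal r \<le> v x" "ereal s \<le> v y"
  shows "ereal (r + s) \<le> v (x * y)"
  using add_mono[OF assms(3,4)] assms(1,2) by (simp add: v_mult)

lemma v_mult_integral_ge:
  assumes "x \<in> K" "y \<in> K" "0 \<le> v x" "ereal s \<le> v y"
  shows "ereal s \<le> v (x * y)"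
  using v_mult_ge[of x y 0 s] assms by (simp add: zero_ereal_def)

lemma v_power: "x \<in> K \<Longrightarrow> v x = ereal r \<Longrightarrow> v (x ^ n) = ereal (real n * r)"
  by (induction n) (simp_all add: v_mult algebra_simps zero_ereal_def)

end

text \<open>In an ultrametric setting a sequence is Cauchy as soon as its consecutive differences
  tend to 0, so only these appear in the hypothesis.\<close>

locale complete_valued_subring = valued_subring +
  assumes complete: "\<lbrakk>\<And>n. y n \<in> K; ((\<lambda>n. v (y (Suc n) - y n)) \<longlongrightarrow> \<infinity>) sequentially\<rbrakk>
    \<Longrightarrow> \<exists>s\<in>K. ((\<lambda>n. v (s - y n)) \<longlongrightarrow> \<infinity>) sequentially"

section \<open>The embedding of the p-adic integers, the order and completeness of the p-adic
  numbers\<close>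

definition qp_of_int :: "'p::prime_card padic_int \<Rightarrow> 'p qp" where
  "qp_of_int z = Fract z 1"

lemma qp_of_int_hom [simp]:
  "qp_of_int 0 = 0" "qp_of_int 1 = 1"
  "qp_of_int (x + y) = qp_of_int x + qp_of_int y"
  "qp_of_int (x - y) = qp_of_int x - qp_of_int y"
  "qp_of_int (x * y) = qp_of_int x * qp_of_int y"
  "qp_of_int (- x) = - qp_of_int x"
  by (simp_all add: qp_of_int_def Zero_fract_def One_fract_def)

lemma qp_of_int_power [simp]: "qp_of_int (x ^ n) = qp_of_int x ^ n"
  by (induction n) simp_all

lemma qp_of_int_of_nat [simp]: "qp_of_int (of_nat n) = of_nat n"
  by (induction n) simp_all

lemma qp_of_int_eq_iff [simp]: "qp_of_int x = qp_of_int y \<longleftrightarrow> x = y"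
  by (simp add: qp_of_int_def eq_fract)

lemma qp_of_int_eq_0_iff [simp]: "qp_of_int x = 0 \<longleftrightarrow> x = 0"
  using qp_of_int_eq_iff[of x 0] by (simp del: qp_of_int_eq_iff)

lemma of_nat_CARD_qp_neq_0 [simp]: "(of_nat CARD('p) :: 'p::prime_card qp) \<noteq> 0"
  using of_nat_CARD_padic_int_neq_0[where 'p='p]
  by (metis qp_of_int_eq_0_iff qp_of_int_of_nat)

lemma qp_prime_power_unit:
  assumes "x \<noteq> (0::'p::prime_card qp)"
  obtains k u where "u dvd 1" and "x = of_nat CARD('p) powi k * qp_of_int u"
proof -
  let ?p = "of_nat CARD('p) :: 'p qp"
  obtain a b where ab: "x = Fract a b" "b \<noteq> 0" by (cases x) auto
  then have "a \<noteq> 0" using assms by (auto simp: Zero_fract_def eq_fract)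
  obtain i u where u: "u dvd 1" "a = of_nat CARD('p) ^ i * u"
    using \<open>a \<noteq> 0\<close> by (rule padic_int_prime_power_unit)
  obtain j w where w: "w dvd 1" "b = of_nat CARD('p) ^ j * w"
    using \<open>b \<noteq> 0\<close> by (rule padic_int_prime_power_unit)
  obtain w' where w': "1 = w * w'" using w(1) by (elim dvdE)
  then have nz: "qp_of_int w \<noteq> 0" by auto
  have ww: "qp_of_int w * qp_of_int w' = 1"
    using w' by (metis qp_of_int_hom(2,5))
  have "x = qp_of_int a / qp_of_int b"
    using ab by (simp add: qp_of_int_def)
  also have "\<dots> = ?p ^ i / ?p ^ j * (qp_of_int u / qp_of_int w)"
    by (simp add: u w)
  also have "?p ^ i / ?p ^ j = ?p powi (int i - int j)"
    by (simp add: power_int_diff)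
  also have "qp_of_int u / qp_of_int w = qp_of_int (u * w')"
    using ww nz by (simp add: field_simps)
  finally have "x = ?p powi (int i - int j) * qp_of_int (u * w')" .
  moreover have "w' dvd 1" using w' by (metis dvdI mult.commute)
  then have "u * w' dvd 1" using u(1) by (simp add: is_unit_mult_iff)
  ultimately show thesis using that by blast
qed

text \<open>Unequal exponents would make \<open>p\<close> divide a unit. This uniqueness gives the
  definite description in \<open>ord_qp\<close> its meaning.\<close>

lemma qp_prime_power_unit_unique:
  fixes u w :: "'p::prime_card padic_int"
  assumes "u dvd 1" "w dvd 1"
    and eq: "of_nat CARD('p) powi k * qp_of_int u = of_nat CARD('p) powi l * qp_of_int w"
  shows "k = l"
proof -
  have le: "k \<ge> l" if "u dvd 1" "w dvd 1"
    and eq: "of_nat CARD('p) powi k * qp_of_int u = of_nat CARD('p) powi l * qp_of_int w"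
  for k l and u w :: "'p padic_int"
  proof (rule ccontr)
    let ?p = "of_nat CARD('p) :: 'p qp"
    assume "\<not> k \<ge> l"
    then obtain n where n: "l = k + int (Suc n)"
      by (metis add.commute linorder_not_le zadd_int_left zless_iff_Suc_zadd)
    have "?p powi k * qp_of_int u = ?p powi k * (?p ^ Suc n * qp_of_int w)"
      using eq unfolding n
      by (subst (asm) power_int_add) (simp_all only: of_nat_CARD_qp_neq_0 power_int_of_nat simp_thms mult.assoc)
    then have "qp_of_int u = ?p ^ Suc n * qp_of_int w" by simp
    also have "\<dots> = qp_of_int (of_nat CARD('p) * (of_nat CARD('p) ^ n * w))"
      by (simp add: mult.assoc)
    finally have "of_nat CARD('p) dvd u" by (simp only: qp_of_int_eq_iff) simp
    then show False using padic_int_not_CARD_dvd_unit that by blast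
  qed
  show ?thesis using le[of u w k l] le[of w u l k] assms by simp
qed

lemma ord_qp_eq:
  assumes "u dvd 1"
  shows "ord_qp (of_nat CARD('p) powi k * qp_of_int (u::'p::prime_card padic_int)) = ereal (of_int k)"
proof -
  have "of_nat CARD('p) powi k * qp_of_int u \<noteq> 0" using assms by auto
  moreover have "(THE k'. \<exists>u'::'p padic_int. u' dvd 1 \<and> of_nat CARD('p) powi k * qp_of_int u
      = of_nat CARD('p) powi k' * Fract u' 1) = k"
    using assms by (intro the_equality)
      (auto simp flip: qp_of_int_def dest: qp_prime_power_unit_unique)
  ultimately show ?thesis by (simp add: ord_qp_def)
qed

lemma ord_qp_0 [simp]: "ord_qp 0 = \<infinity>"
  by (simp add: ord_qp_def)

lemma ord_qp_nonzero: "x \<noteq> 0 \<Longrightarrow> \<exists>k. ord_qp x = ereal (of_int k)"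
  by (metis qp_prime_power_unit ord_qp_eq)

text \<open>Trades the definite description for a factorisation: the ultrametric inequality becomes
  pulling out a common power of \<open>p\<close>, and convergence becomes divisibility in the p-adic
  integers.\<close>

lemma ord_qp_ge_iff:
  "ereal (of_int k) \<le> ord_qp (x::'p::prime_card qp)
    \<longleftrightarrow> (\<exists>z. x = of_nat CARD('p) powi k * qp_of_int z)"
proof
  let ?p = "of_nat CARD('p) :: 'p qp"
  assume a: "ereal (of_int k) \<le> ord_qp x"
  show "\<exists>z. x = ?p powi k * qp_of_int z"
  proof (cases "x = 0")
    case True
    then show ?thesis by (intro exI[of _ 0]) simp
  next
    case False
    then obtain l u where u: "u dvd 1" and x: "x = ?p powi l * qp_of_int u"
      by (rule qp_prime_power_unit)
    have "k \<le> l" using a ord_qp_eq[OF u, of l] x by simp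
    then obtain n where n: "l = k + int n" using zle_iff_zadd by blast
    have "x = ?p powi k * qp_of_int (of_nat CARD('p) ^ n * u)"
      unfolding x n by (simp add: power_int_add mult.assoc)
    then show ?thesis by blast
  qed
next
  let ?p = "of_nat CARD('p) :: 'p qp"
  assume "\<exists>z. x = ?p powi k * qp_of_int z"
  then obtain z where x: "x = ?p powi k * qp_of_int z" by blast
  show "ereal (of_int k) \<le> ord_qp x"
  proof (cases "z = 0")
    case False
    then obtain n u where u: "u dvd 1" and z: "z = of_nat CARD('p) ^ n * u"
      by (rule padic_int_prime_power_unit)
    have "x = ?p powi (k + int n) * qp_of_int u"
      unfolding x z by (simp add: power_int_add mult.assoc)
    then show ?thesis using ord_qp_eq[OF u, of "k + int n"] by simp
  qed (simp add: x)
qed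

lemma ord_qp_ge_0_iff: "0 \<le> ord_qp x \<longleftrightarrow> x \<in> range qp_of_int"
  using ord_qp_ge_iff[of 0 x] by (auto simp: zero_ereal_def)

lemma ord_qp_CARD: "ord_qp (of_nat CARD('p) :: 'p::prime_card qp) = 1"
  using ord_qp_eq[of "1::'p padic_int" 1] by (simp add: one_ereal_def)

lemma valuation_ord_qp: "valuation_on UNIV (ord_qp :: 'p::prime_card qp \<Rightarrow> ereal)"
  unfolding valuation_on_def
proof (intro conjI ballI)
  fix x y :: "'p qp"
  let ?p = "of_nat CARD('p) :: 'p qp"
  show "ord_qp x \<noteq> - \<infinity>" "(ord_qp x = \<infinity>) = (x = 0)"
    using ord_qp_nonzero[of x] by (cases "x = 0"; auto)+
  show "ord_qp (x * y) = ord_qp x + ord_qp y"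
  proof (cases "x = 0 \<or> y = 0")
    case True
    then show ?thesis using ord_qp_nonzero[of x] ord_qp_nonzero[of y] by (cases "x = 0"; cases "y = 0") auto
  next
    case False
    then have nz: "x \<noteq> 0" "y \<noteq> 0" by auto
    obtain k u where u: "u dvd 1" and x: "x = ?p powi k * qp_of_int u"
      using nz(1) by (rule qp_prime_power_unit)
    obtain l w where w: "w dvd 1" and y: "y = ?p powi l * qp_of_int w"
      using nz(2) by (rule qp_prime_power_unit)
    have "x * y = ?p powi (k + l) * qp_of_int (u * w)"
      unfolding x y by (simp add: power_int_add)
    moreover have "u * w dvd 1" using u w by (simp add: is_unit_mult_iff)
    ultimately have "ord_qp (x * y) = ereal (of_int (k + l))"
      using ord_qp_eq[of "u * w" "k + l"] by simp
    moreover have "ord_qp x = ereal (of_int k)" "ord_qp y = ereal (of_int l)"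
      using ord_qp_eq[OF u, of k] ord_qp_eq[OF w, of l] x y by simp_all
    ultimately show ?thesis by simp
  qed
  show "min (ord_qp x) (ord_qp y) \<le> ord_qp (x + y)"
  proof (cases "x = 0 \<or> y = 0")
    case False
    then obtain k where k: "min (ord_qp x) (ord_qp y) = ereal (of_int k)"
      using ord_qp_nonzero[of x] ord_qp_nonzero[of y] by (metis min_def)
    then have "ereal (of_int k) \<le> ord_qp x" "ereal (of_int k) \<le> ord_qp y"
      by (metis min.cobounded1, metis min.cobounded2)
    then obtain z z' where "x = ?p powi k * qp_of_int z" "y = ?p powi k * qp_of_int z'"
      unfolding ord_qp_ge_iff by blast
    then have "x + y = ?p powi k * qp_of_int (z + z')" by (simp add: distrib_left)
    then show ?thesis unfolding k ord_qp_ge_iff by blast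
  qed auto
qed

text \<open>From some index \<open>N\<close> on, consecutive differences are integral. So the tail
  minus \<open>y N\<close> lies in the p-adic integers, where
  \<open>padic_int_Cauchy_convergent\<close> provides the limit.\<close>

lemma complete_valued_qp: "complete_valued_subring UNIV (ord_qp :: 'p::prime_card qp \<Rightarrow> ereal)"
proof -
  interpret valued_subring UNIV "ord_qp :: 'p qp \<Rightarrow> ereal"
    by unfold_locales (simp_all add: valuation_ord_qp)
  show ?thesis
  proof
    fix y :: "nat \<Rightarrow> 'p qp"
    assume cau: "((\<lambda>n. ord_qp (y (Suc n) - y n)) \<longlongrightarrow> \<infinity>) sequentially"
    then have "\<forall>\<^sub>F n in sequentially. ereal 0 < ord_qp (y (Suc n) - y n)"
      unfolding tendsto_PInfty by blast
    then obtain N where N: "\<And>n. n \<ge> N \<Longrightarrow> 0 \<le> ord_qp (y (Suc n) - y n)"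
      by (auto simp: eventually_sequentially zero_ereal_def intro: less_imp_le)
    have "y (n + N) - y N \<in> range qp_of_int" for n
    proof (induction n)
      case 0
      then show ?case using qp_of_int_hom(1) by (metis add_0 diff_self rangeI)
    next
      case (Suc n)
      have "y (Suc (n + N)) - y (n + N) \<in> range qp_of_int"
        using N[of "n + N"] by (simp add: ord_qp_ge_0_iff)
      with Suc obtain a c where "y (n + N) - y N = qp_of_int a"
        "y (Suc (n + N)) - y (n + N) = qp_of_int c" by auto
      then have "y (Suc n + N) - y N = qp_of_int (c + a)"
        by (simp add: algebra_simps)
      then show ?case by blast
    qed
    then have "\<forall>n. \<exists>w. y (n + N) - y N = qp_of_int w" by blast
    then obtain z where z: "\<And>n. y (n + N) - y N = qp_of_int (z n)" by metis
    have dvd: "of_nat CARD('p) ^ m dvd a" if "ereal (real m) < ord_qp (qp_of_int a)" for m and a :: "'p padic_int"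
    proof -
      have "ereal (of_int (int m)) \<le> ord_qp (qp_of_int a)" using that by simp
      then obtain c where "qp_of_int a = qp_of_int (of_nat CARD('p) ^ m * c)"
        unfolding ord_qp_ge_iff by auto
      then show ?thesis by (simp only: qp_of_int_eq_iff) simp
    qed
    have "\<forall>\<^sub>F n in sequentially. of_nat CARD('p) ^ m dvd z (Suc n) - z n" for m
    proof -
      have "\<forall>\<^sub>F n in sequentially. ereal (real m) < ord_qp (y (Suc n) - y n)"
        using cau unfolding tendsto_PInfty by blast
      then have "\<forall>\<^sub>F n in sequentially. ereal (real m) < ord_qp (y (Suc (n + N)) - y (n + N))"
        by (rule eventually_compose_filterlim) (rule filterlim_add_const_nat_at_top)
      then show ?thesis
      proof eventually_elim
        case (elim n)
        have "y (Suc (n + N)) - y (n + N) = qp_of_int (z (Suc n) - z n)"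
          using z[of n] z[of "Suc n"] by (simp add: algebra_simps)
        then show ?case using elim dvd by simp
      qed
    qed
    then obtain s where s: "\<And>m. \<forall>\<^sub>F n in sequentially. of_nat CARD('p) ^ m dvd s - z n"
      using padic_int_Cauchy_convergent[of z] by blast
    have "((\<lambda>n. ord_qp (y N + qp_of_int s - y (n + N))) \<longlongrightarrow> \<infinity>) sequentially"
      unfolding tendsto_PInfty
    proof
      fix r :: real
      obtain m :: nat where m: "r < real m" using reals_Archimedean2 by blast
      show "\<forall>\<^sub>F n in sequentially. ereal r < ord_qp (y N + qp_of_int s - y (n + N))"
        using s[of m]
      proof eventually_elim
        case (elim n)
        then obtain c where c: "s - z n = of_nat CARD('p) ^ m * c" by (elim dvdE)
        have "y N + qp_of_int s - y (n + N) = qp_of_int (s - z n)"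
          using z[of n] by (simp add: algebra_simps)
        also have "\<dots> = of_nat CARD('p) powi (int m) * qp_of_int c" by (simp only: c) simp
        finally have "ereal (of_int (int m)) \<le> ord_qp (y N + qp_of_int s - y (n + N))"
          unfolding ord_qp_ge_iff by blast
        moreover have "ereal r < ereal (of_int (int m))" using m by simp
        ultimately show ?case by (meson order_less_le_trans)
      qed
    qed
    then have "((\<lambda>n. ord_qp (y N + qp_of_int s - y n)) \<longlongrightarrow> \<infinity>) sequentially"
      by (rule LIMSEQ_offset)
    then show "\<exists>s\<in>UNIV. ((\<lambda>n. ord_qp (s - y n)) \<longlongrightarrow> \<infinity>) sequentially" by blast
  qed
qed

section \<open>The ramified extension\<close>

lemma add_ereal_less:
  assumes "ereal x \<le> u" "ereal y < w" shows "ereal (x + y) < u + w"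
  using assms by (cases u; cases w) auto

text \<open>The argument is that of an Eisenstein polynomial \<open>X ^ e + p\<close> with arbitrary
  ramification index; the theorem takes \<open>e = p - 1\<close>.\<close>

locale eisenstein_root =
  fixes \<pi> :: "'p::prime_card qp_bar" and e :: nat
  assumes e_pos: "e > 0" and pi_power: "\<pi> ^ e = - of_nat CARD('p)"
begin

sublocale qp: complete_valued_subring UNIV "ord_qp :: 'p qp \<Rightarrow> ereal"
  by (rule complete_valued_qp)

text \<open>Elements of \<open>Omega\<close> are studied through polynomial representatives, which
  become unique once their degree is below \<open>e\<close>.\<close>

definition eval :: "'p qp poly \<Rightarrow> 'p qp_bar" where
  "eval f = poly (map_poly to_ac f) \<pi>"

lemma eval_0 [simp]: "eval 0 = 0"
  by (simp add: eval_def)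

lemma eval_pCons [simp]: "eval (pCons a f) = to_ac a + \<pi> * eval f"
  by (simp add: eval_def Polynomial.map_poly_pCons)

lemma eval_1 [simp]: "eval 1 = 1"
  by (simp add: one_pCons)

lemma eval_add [simp]: "eval (f + g) = eval f + eval g"
proof (induction f arbitrary: g)
  case (pCons a f)
  obtain c h where g: "g = pCons c h" by (cases g)
  show ?case by (simp add: g pCons.IH distrib_left)
qed simp

lemma eval_smult [simp]: "eval (smult a f) = to_ac a * eval f"
  by (induction f) (simp_all add: algebra_simps)

lemma eval_minus [simp]: "eval (- f) = - eval f"
  using eval_smult[of "- 1" f] by simp

lemma eval_diff [simp]: "eval (f - g) = eval f - eval g"
  using eval_add[of f "- g"] by simp

lemma eval_mult [simp]: "eval (f * g) = eval f * eval g"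
  by (induction f) (simp_all add: algebra_simps)

lemma eval_monom [simp]: "eval (monom a n) = to_ac a * \<pi> ^ n"
  by (simp add: eval_def map_poly_monom poly_monom)

lemma eval_altdef: "eval f = (\<Sum>i\<le>degree f. to_ac (coeff f i) * \<pi> ^ i)"
proof -
  have "degree (map_poly to_ac f) = degree f" by (rule degree_map_poly) auto
  then show ?thesis by (simp add: eval_def poly_altdef coeff_map_poly)
qed

text \<open>The term of degree \<open>i\<close> is the only one of least order when \<open>\<pi>\<close>, of order \<open>1 / e\<close>, is substituted,
  and that order is \<open>r\<close>.\<close>

definition dominant :: "'p qp poly \<Rightarrow> nat \<Rightarrow> real \<Rightarrow> bool" where
  "dominant f i r \<longleftrightarrow> ord_qp (coeff f i) = ereal (r - real i / real e) \<and>
     (\<forall>j. j \<noteq> i \<longrightarrow> ereal (r - real j / real e) < ord_qp (coeff f j))"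

lemma dominant_ge: "dominant f i r \<Longrightarrow> ereal (r - real j / real e) \<le> ord_qp (coeff f j)"
  unfolding dominant_def by (cases "j = i") (auto intro: less_imp_le)

lemma dominant_nonzero: "dominant f i r \<Longrightarrow> coeff f i \<noteq> 0"
  by (auto simp: dominant_def)

text \<open>If \<open>i\<close> and \<open>j\<close> differed, strictness at \<open>j\<close> for
  the first and at \<open>i\<close> for the second would give both \<open>r < s\<close> and
  \<open>s < r\<close>.\<close>

lemma dominant_unique:
  assumes "dominant f i r" "dominant f j s" shows "i = j" and "r = s"
proof -
  show "i = j"
  proof (rule ccontr)
    assume "i \<noteq> j"
    then have "ereal (r - real j / real e) < ereal (s - real j / real e)"
      "ereal (s - real i / real e) < ereal (r - real i / real e)"
      using assms by (metis dominant_def)+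
    then show False by simp
  qed
  then show "r = s" using assms by (simp add: dominant_def)
qed

text \<open>Two terms of degree below \<open>e\<close> never have the same order, as these orders differ modulo 1.\<close>

lemma dominant_exists:
  assumes "f \<noteq> 0" "degree f < e"
  obtains i r where "i < e" "dominant f i r"
proof -
  define \<tau> where "\<tau> i = ord_qp (coeff f i) + ereal (real i / real e)" for i
  have ne: "{..<e} \<noteq> {}" using e_pos by auto
  then obtain i where i: "i < e" and min: "\<And>j. j < e \<Longrightarrow> \<tau> i \<le> \<tau> j"
    using Min_in[of "\<tau> ` {..<e}"] Min_le[of "\<tau> ` {..<e}"] by (metis (no_types, lifting)
      finite_imageI finite_lessThan image_iff image_is_empty lessThan_iff)
  \<comment> \<open>The leading term has finite order, hence so does the minimal one.\<close>
  have "\<tau> (degree f) \<noteq> \<infinity>"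
    using assms(1) by (simp add: \<tau>_def)
  then have "\<tau> i \<noteq> \<infinity>" using min[OF assms(2)] by auto
  then have nz: "coeff f i \<noteq> 0" by (auto simp: \<tau>_def)
  then obtain k where k: "ord_qp (coeff f i) = ereal (of_int k)"
    using ord_qp_nonzero by blast
  define r where "r = of_int k + real i / real e"
  have "ereal (r - real j / real e) < ord_qp (coeff f j)" if "j \<noteq> i" for j
  proof (cases "coeff f j = 0")
    case False
    then have j: "j < e" using assms(2) le_degree[of f j] by simp
    obtain l where l: "ord_qp (coeff f j) = ereal (of_int l)"
      using ord_qp_nonzero[OF False] by blast
    have le: "r \<le> of_int l + real j / real e" using min[OF j] by (simp add: \<tau>_def k l r_def)
    have "r \<noteq> of_int l + real j / real e"
    proof
      assume "r = of_int l + real j / real e"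
      \<comment> \<open>Multiplied by \<open>e\<close>, equality of the two orders is an equation
        between integers; modulo \<open>e\<close> it says \<open>i = j\<close>.\<close>
      then have "(of_int k + real i / real e) * real e = (of_int l + real j / real e) * real e"
        by (simp only: r_def)
      then have "of_int k * real e + real i = of_int l * real e + real j"
        using e_pos by (simp add: distrib_right)
      then have "real_of_int (k * int e + int i) = real_of_int (l * int e + int j)" by simp
      then have eq: "k * int e + int i = l * int e + int j" by (simp only: of_int_eq_iff)
      then have "(k * int e + int i) mod int e = (l * int e + int j) mod int e" by simp
      then show False using i j \<open>j \<noteq> i\<close> by simp
    qed
    then show ?thesis using le l by simp
  qed simp
  then have "dominant f i r" by (simp add: dominant_def k r_def)
  then show thesis using that i by blast
qed

text \<open>As in Gauss's lemma: of all products of a term of \<open>f\<close> with a term of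
  \<open>g\<close>, only the pair \<open>(i, j)\<close> attains order \<open>r + s\<close>, so
  nothing can cancel it in degree \<open>i + j\<close>.\<close>

lemma dominant_mult:
  assumes f: "dominant f i r" and g: "dominant g j s"
  shows "dominant (f * g) (i + j) (r + s)"
proof -
  have tm: "ereal (r + s - real (a + c) / real e) < ord_qp (coeff f a * coeff g c)"
    if "\<not> (a = i \<and> c = j)" for a c
  proof -
    have "ereal ((r - real a / real e) + (s - real c / real e)) < ord_qp (coeff f a) + ord_qp (coeff g c)"
    proof (cases "c = j")
      case True
      then have "ereal (r - real a / real e) < ord_qp (coeff f a)"
        using f that by (auto simp: dominant_def)
      from add_ereal_less[OF dominant_ge[OF g, of c] this] show ?thesis
        by (simp add: add.commute)
    next
      case False
      then have "ereal (s - real c / real e) < ord_qp (coeff g c)"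
        using g by (auto simp: dominant_def)
      from add_ereal_less[OF dominant_ge[OF f, of a] this] show ?thesis .
    qed
    then show ?thesis by (simp add: qp.v_mult add_divide_distrib algebra_simps)
  qed
  have lead: "ord_qp (coeff f i * coeff g j) = ereal (r + s - real (i + j) / real e)"
    using f g by (simp add: qp.v_mult dominant_def add_divide_distrib)
  show ?thesis
    unfolding dominant_def
  proof (intro conjI allI impI)
    have "ord_qp (coeff (f * g) (i + j)) = ord_qp (coeff f i * coeff g (i + j - i))"
      unfolding coeff_mult
    proof (rule qp.v_sum_eq_dominant)
      fix a assume a: "a \<in> {..i + j}" "a \<noteq> i"
      then show "ord_qp (coeff f i * coeff g (i + j - i)) < ord_qp (coeff f a * coeff g (i + j - a))"
        using tm[of a "i + j - a"] lead by simp
    qed (use dominant_nonzero[OF f] dominant_nonzero[OF g] in auto)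
    then show "ord_qp (coeff (f * g) (i + j)) = ereal (r + s - real (i + j) / real e)"
      using lead by simp
  next
    fix k assume k: "k \<noteq> i + j"
    show "ereal (r + s - real k / real e) < ord_qp (coeff (f * g) k)"
      unfolding coeff_mult
    proof (rule qp.v_sum_gt)
      fix a assume a: "a \<in> {..k}"
      then show "coeff f a * coeff g (k - a) \<in> UNIV \<and>
          ereal (r + s - real k / real e) < ord_qp (coeff f a * coeff g (k - a))"
        using tm[of a "k - a"] k by (cases "a = i") auto
    qed simp
  qed
qed

section \<open>The Eisenstein polynomial\<close>

definition eis_poly :: "'p qp poly" where
  "eis_poly = monom 1 e + [:of_nat CARD('p):]"

lemma coeff_eis_poly:
  "coeff eis_poly i = (if i = e then 1 else if i = 0 then of_nat CARD('p) else 0)"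
  using e_pos by (auto simp: eis_poly_def coeff_pCons split: nat.splits)

lemma degree_eis_poly: "degree eis_poly = e"
  by (rule antisym) (auto intro!: degree_le le_degree simp: coeff_eis_poly)

lemma eis_poly_nonzero [simp]: "eis_poly \<noteq> 0"
  using degree_eis_poly e_pos by auto

lemma eval_eis_poly [simp]: "eval eis_poly = 0"
  by (simp add: eis_poly_def pi_power)

text \<open>After substituting \<open>\<pi>\<close> its two terms tie: both \<open>X ^ e\<close> and
  the constant \<open>p\<close> get order 1.\<close>

lemma not_dominant_eis_poly: "\<not> dominant eis_poly i r"
proof
  assume d: "dominant eis_poly i r"
  then have "i = e \<or> i = 0"
    using dominant_nonzero[OF d] by (auto simp: coeff_eis_poly split: if_splits)
  moreover have "ord_qp (coeff eis_poly e) = ereal 0" "ord_qp (coeff eis_poly 0) = ereal 1"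
    using e_pos by (simp_all add: coeff_eis_poly ord_qp_CARD one_ereal_def zero_ereal_def)
  moreover have "ereal (r - real j / real e) < ord_qp (coeff eis_poly j)" if "j \<noteq> i" for j
    using d that by (simp add: dominant_def)
  from this[of 0] this[of e]
  have "i \<noteq> 0 \<Longrightarrow> ereal r < ord_qp (coeff eis_poly 0)"
    "i \<noteq> e \<Longrightarrow> ereal (r - 1) < ord_qp (coeff eis_poly e)"
    using e_pos by auto
  moreover have "ord_qp (coeff eis_poly i) = ereal (r - real i / real e)"
    using d by (simp add: dominant_def)
  ultimately show False using e_pos by auto
qed

text \<open>Irreducibility of the Eisenstein polynomial: a factorisation into polynomials of smaller degree
  would give it a dominant term.\<close>

lemma one_in_ideal:
  assumes I: "\<And>f g q. f \<in> I \<Longrightarrow> g \<in> I \<Longrightarrow> f - q * g \<in> I" and "eis_poly \<in> I"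
    and "f \<in> I" "f \<noteq> 0" "degree f < e"
  shows "1 \<in> I"
proof -
  \<comment> \<open>An element of least positive-or-zero degree divides \<open>eis_poly\<close>,
    since the remainder lies in \<open>I\<close> and has smaller degree unless it is 0.\<close>
  obtain d where d: "d \<in> I" "d \<noteq> 0" and min: "\<And>g. g \<in> I \<Longrightarrow> g \<noteq> 0 \<Longrightarrow> degree d \<le> degree g"
    using ex_has_least_nat[of "\<lambda>g. g \<in> I \<and> g \<noteq> 0" f degree] assms by blast
  have de: "degree d < e" using min[of f] assms by simp
  define q where "q = eis_poly div d"
  have "eis_poly mod d = eis_poly - q * d" by (simp add: q_def minus_div_mult_eq_mod)
  then have "eis_poly mod d \<in> I" using I assms(2) d(1) by simp
  then have "eis_poly mod d = 0"
    using min[of "eis_poly mod d"] degree_mod_less'[OF d(2), of eis_poly] by fastforce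
  then have M: "eis_poly = q * d" by (simp add: q_def mod_0_imp_dvd)
  then have q0: "q \<noteq> 0" using eis_poly_nonzero by auto
  have "degree d = 0"
  proof (rule ccontr)
    assume "degree d \<noteq> 0"
    moreover have "degree q + degree d = e"
      using degree_mult_eq[OF q0 d(2)] M degree_eis_poly by simp
    ultimately have qe: "degree q < e" by simp
    obtain i r where ir: "dominant q i r" using dominant_exists[OF q0 qe] .
    obtain j s where js: "dominant d j s" using dominant_exists[OF d(2) de] .
    show False using dominant_mult[OF ir js] M not_dominant_eis_poly by simp
  qed
  then obtain c where c: "d = [:c:]" by (rule degree_eq_zeroE)
  then have "c \<noteq> 0" using d(2) by auto
  \<comment> \<open>The closure property of \<open>I\<close> has the form \<open>f - q * g\<close>,
    so 1 is reached as 0 minus a multiple of the constant \<open>d\<close>.\<close>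
  have "0 \<in> I" using I[OF d(1) d(1), of 1] by simp
  from I[OF this d(1), of "[:- inverse c:]"] show ?thesis
    using \<open>c \<noteq> 0\<close> by (simp add: c one_pCons)
qed

section \<open>Reduced representatives, inverses and the description of \<open>Omega\<close>\<close>

lemma eval_eq_0_imp:
  assumes "eval f = 0" "degree f < e" shows "f = 0"
proof (rule ccontr)
  assume "f \<noteq> 0"
  \<comment> \<open>The ideal is the kernel of \<open>eval\<close>, which contains
    \<open>eis_poly\<close> but not 1.\<close>
  then have "1 \<in> {f. eval f = 0}"
    using assms by (intro one_in_ideal[where f = f]) auto
  then show False by simp
qed

lemma eval_reduced:
  obtains g where "degree g < e" "eval g = eval f"
proof
  have "degree eis_poly > 0" using e_pos degree_eis_poly by simp
  then show "degree (f mod eis_poly) < e"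
    using degree_mod_less[OF eis_poly_nonzero, of f] e_pos degree_eis_poly by auto
  have "eval f = eval (f div eis_poly * eis_poly + f mod eis_poly)" by simp
  also have "\<dots> = eval (f mod eis_poly)" by (simp only: eval_add eval_mult) simp
  finally show "eval (f mod eis_poly) = eval f" by simp
qed

text \<open>The polynomials whose value is a multiple of \<open>eval f\<close> form an ideal. It
  contains \<open>eis_poly\<close>, of value 0, and a nonzero reduced representative of
  \<open>eval f\<close>, hence 1.\<close>

lemma eval_inverse:
  assumes "eval f \<noteq> 0"
  obtains g where "eval f * eval g = 1"
proof -
  obtain h where h: "degree h < e" "eval h = eval f" by (rule eval_reduced)
  have "1 \<in> {h. \<exists>g. eval h = eval f * eval g}"
  proof (rule one_in_ideal[where f = h])
    fix u w q assume "u \<in> {h. \<exists>g. eval h = eval f * eval g}" "w \<in> {h. \<exists>g. eval h = eval f * eval g}"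
    then obtain a c where ac: "eval u = eval f * eval a" "eval w = eval f * eval c" by auto
    have "eval (u - q * w) = eval f * eval (a - q * c)"
      by (simp add: ac algebra_simps)
    then show "u - q * w \<in> {h. \<exists>g. eval h = eval f * eval g}" by blast
  next
    show "eis_poly \<in> {h. \<exists>g. eval h = eval f * eval g}" by (auto intro: exI[of _ 0])
    show "h \<in> {h. \<exists>g. eval h = eval f * eval g}" using h by (auto intro!: exI[of _ 1])
    show "h \<noteq> 0" using assms h by auto
  qed (rule h)
  then show thesis using that by auto
qed

text \<open>The image of \<open>eval\<close> is visibly a ring; closure under inverses, the
  \<open>m_inv\<close> case, rests on \<open>eval_inverse\<close>.\<close>

lemma Omega_eq_range_eval: "Omega \<pi> = range eval"
proof
  interpret F: field "ring_of_type_algebra :: 'p qp_bar ring"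
    by (rule field_from_type_algebra)
  note defs = ring_of_type_algebra_def
  have ainv: "\<ominus>\<^bsub>ring_of_type_algebra\<^esub> h = - h" for h :: "'p qp_bar"
    by (rule F.minus_equality) (simp_all add: defs)
  have minv: "inv\<^bsub>ring_of_type_algebra\<^esub> h = inverse h" if "h \<noteq> 0" for h :: "'p qp_bar"
    using F.inv_unique'[of h "inverse h"] that by (simp add: defs)
  show "Omega \<pi> \<subseteq> range eval"
  proof
    fix x assume "x \<in> Omega \<pi>"
    then show "x \<in> range eval"
      unfolding Omega_def
    proof (induction rule: generate_field.induct)
      case one
      have "\<one>\<^bsub>ring_of_type_algebra\<^esub> = eval 1" by (simp add: defs)
      then show ?case by (rule range_eqI)
    next
      case (incl h)
      have "\<pi> = eval (monom 1 1)" by simp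
      moreover have "to_ac a = eval [:a:]" for a by simp
      ultimately show ?case using incl by blast
    next
      case (a_inv h)
      then obtain f where "h = eval f" by auto
      then have "\<ominus>\<^bsub>ring_of_type_algebra\<^esub> h = eval (- f)" by (simp add: ainv)
      then show ?case by (rule range_eqI)
    next
      case (m_inv h)
      then have nz: "h \<noteq> 0" by (simp add: defs)
      obtain f where f: "h = eval f" using m_inv by auto
      obtain g where "eval f * eval g = 1" using eval_inverse nz f by blast
      then have "inverse h = eval g" using f inverse_unique by blast
      then show ?case using minv[OF nz] by (metis rangeI)
    next
      case (eng_add h1 h2)
      then obtain f g where "h1 = eval f" "h2 = eval g" by auto
      then have "h1 \<oplus>\<^bsub>ring_of_type_algebra\<^esub> h2 = eval (f + g)" by (simp add: defs)
      then show ?case by (rule range_eqI)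
    next
      case (eng_mult h1 h2)
      then obtain f g where "h1 = eval f" "h2 = eval g" by auto
      then have "h1 \<otimes>\<^bsub>ring_of_type_algebra\<^esub> h2 = eval (f * g)" by (simp add: defs)
      then show ?case by (rule range_eqI)
    qed
  qed
  have pi: "\<pi> \<in> Omega \<pi>" and ac: "to_ac a \<in> Omega \<pi>" for a
    unfolding Omega_def by (rule generate_field.incl, simp)+
  have "eval f \<in> Omega \<pi>" for f
  proof (induction f)
    case 0
    then show ?case using ac[of 0] by simp
  next
    case (pCons a f)
    have "to_ac a \<oplus>\<^bsub>ring_of_type_algebra\<^esub> (\<pi> \<otimes>\<^bsub>ring_of_type_algebra\<^esub> eval f) \<in> Omega \<pi>"
      using pi ac[of a] pCons unfolding Omega_def
      by (intro generate_field.eng_add generate_field.eng_mult)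
    then show ?case by (simp add: defs)
  qed
  then show "range eval \<subseteq> Omega \<pi>" by blast
qed

lemma Omega_cases:
  assumes "x \<in> Omega \<pi>"
  obtains f where "degree f < e" "x = eval f"
proof -
  obtain h where h: "x = eval h" using assms unfolding Omega_eq_range_eval by blast
  obtain g where "degree g < e" "eval g = eval h" by (rule eval_reduced)
  then show thesis using that[of g] h by simp
qed

lemma Omega_nonzero_cases:
  assumes "x \<in> Omega \<pi>" "x \<noteq> 0"
  obtains f i r where "degree f < e" "x = eval f" "i < e" "dominant f i r"
proof -
  obtain f where f: "degree f < e" "x = eval f" using assms(1) by (rule Omega_cases)
  then have "f \<noteq> 0" using assms by auto
  then obtain i r where "i < e" "dominant f i r" using f(1) by (rule dominant_exists)
  then show thesis using that f by blast
qed

section \<open>The valuation of \<open>Omega\<close>\<close>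

lemma eval_eq_imp: "eval f = eval g \<Longrightarrow> degree f < e \<Longrightarrow> degree g < e \<Longrightarrow> f = g"
  using eval_eq_0_imp[of "f - g"] degree_diff_less[of f e g] by simp

text \<open>The value is well defined: the reduced representative is unique by
  \<open>eval_eq_imp\<close>, and so is its dominant order by
  \<open>dominant_unique\<close>.\<close>

definition val :: "'p qp_bar \<Rightarrow> ereal" where
  "val x = (if x = 0 then \<infinity> else
     ereal (THE r. \<exists>f i. degree f < e \<and> eval f = x \<and> dominant f i r))"

lemma val_eval:
  assumes "degree f < e" "dominant f i r" shows "val (eval f) = ereal r"
proof -
  have "eval f \<noteq> 0" using assms eval_eq_0_imp dominant_nonzero by force
  moreover have "(THE r. \<exists>g i. degree g < e \<and> eval g = eval f \<and> dominant g i r) = r"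
    using assms by (intro the_equality) (auto dest: eval_eq_imp dominant_unique)
  ultimately show ?thesis by (simp add: val_def)
qed

text \<open>Bounds on \<open>val\<close> become coefficientwise bounds, which reduces the
  ultrametric inequality and completeness to the p-adic numbers.\<close>

lemma val_eval_ge_iff:
  assumes "degree f < e"
  shows "ereal s \<le> val (eval f) \<longleftrightarrow> (\<forall>i. ereal (s - real i / real e) \<le> ord_qp (coeff f i))"
proof (cases "f = 0")
  case False
  then obtain i r where d: "dominant f i r" using assms by (rule dominant_exists)
  show ?thesis
  proof
    assume "ereal s \<le> val (eval f)"
    then have "s \<le> r" using val_eval[OF assms d] by simp
    then show "\<forall>i. ereal (s - real i / real e) \<le> ord_qp (coeff f i)"
      using dominant_ge[OF d] by (meson diff_right_mono ereal_less_eq(3) order_trans)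
  next
    assume "\<forall>i. ereal (s - real i / real e) \<le> ord_qp (coeff f i)"
    then have "ereal (s - real i / real e) \<le> ereal (r - real i / real e)"
      using d by (metis dominant_def)
    then show "ereal s \<le> val (eval f)" using val_eval[OF assms d] by simp
  qed
qed (simp add: val_def)

text \<open>A product of reduced polynomials has degree below \<open>2 * e\<close>, so folding
  \<open>X ^ (i + e)\<close> to \<open>- p * X ^ i\<close> once is enough. Folding preserves the
  order of every term at \<open>\<pi>\<close>, and the dominant one, moved to index
  \<open>k mod e\<close>, meets only terms of strictly larger order.\<close>

lemma dominant_reduce:
  assumes deg: "degree h < 2 * e" and d: "dominant h k r"
  obtains g i where "degree g < e" "eval g = eval h" "dominant g i r"
proof
  let ?p = "of_nat CARD('p) :: 'p qp"
  define g where "g = poly_cutoff e h - smult ?p (poly_shift e h)"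
  have c: "coeff g i = (if i < e then coeff h i else 0) - ?p * coeff h (i + e)" for i
    by (simp add: g_def coeff_poly_cutoff coeff_poly_shift)
  have big: "coeff h (i + e) = 0" if "i \<ge> e" for i
    using that deg by (intro coeff_eq_0) simp
  have c0: "coeff g i = 0" if "i \<ge> e" for i using that big by (simp add: c)
  show "degree g < e"
  proof (rule ccontr)
    assume "\<not> degree g < e"
    then have "coeff g (degree g) = 0" using c0 by simp
    then have "g = 0" by simp
    then show False using e_pos \<open>\<not> degree g < e\<close> by simp
  qed
  have "h = poly_cutoff e h + monom 1 e * poly_shift e h"
    by (rule poly_eqI) (simp add: coeff_poly_cutoff coeff_poly_shift coeff_monom_mult)
  then have "eval h = eval (poly_cutoff e h) + eval (monom 1 e * poly_shift e h)"
    by (metis eval_add)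
  then show "eval g = eval h" by (simp add: g_def pi_power)
  have ord_p: "ord_qp (?p * x) = 1 + ord_qp x" for x
    by (simp add: qp.v_mult ord_qp_CARD)
  have shift: "ereal (r - real i / real e) = 1 + ereal (r - real (i + e) / real e)" for i
    using e_pos by (simp add: one_ereal_def field_simps)
  have k: "k < 2 * e" using dominant_nonzero[OF d] le_degree[of h k] deg by simp
  have gt: "ereal (r - real i / real e) < ord_qp (coeff h i)" if "i \<noteq> k" for i
    using d that by (simp add: dominant_def)
  have gt': "ereal (r - real i / real e) < ord_qp (- (?p * coeff h (i + e)))" if "i + e \<noteq> k" for i
  proof -
    have "1 + ereal (r - real (i + e) / real e) < 1 + ord_qp (coeff h (i + e))"
      using gt[OF that] by (cases "ord_qp (coeff h (i + e))") (auto simp: one_ereal_def)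
    then show ?thesis by (subst shift) (simp only: qp.v_minus[OF UNIV_I] ord_p)
  qed
  show "dominant g (k mod e) r"
    unfolding dominant_def
  proof (intro conjI allI impI)
    show "ord_qp (coeff g (k mod e)) = ereal (r - real (k mod e) / real e)"
    proof (cases "k < e")
      case True
      have "ord_qp (coeff h k + - (?p * coeff h (k + e))) = ord_qp (coeff h k)"
        using d gt'[of k] e_pos by (intro qp.v_add_eq) (auto simp: dominant_def)
      then show ?thesis using True d by (simp add: c dominant_def)
    next
      case False
      then have m: "k mod e + e = k" using k le_mod_geq[of e k] by simp
      have o: "ord_qp (- (?p * coeff h k)) = ereal (r - real (k mod e) / real e)"
        using d shift[of "k mod e"] unfolding m by (simp add: ord_p dominant_def)
      moreover have "k mod e \<noteq> k" using False e_pos by (metis mod_less_divisor)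
      ultimately have "ord_qp (- (?p * coeff h k) + coeff h (k mod e)) = ord_qp (- (?p * coeff h k))"
        using gt[of "k mod e"] by (intro qp.v_add_eq) auto
      then show ?thesis using o e_pos by (simp add: c m)
    qed
  next
    fix i assume i: "i \<noteq> k mod e"
    show "ereal (r - real i / real e) < ord_qp (coeff g i)"
    proof (cases "i < e")
      case True
      then have "i \<noteq> k" "i + e \<noteq> k" using i by auto
      then have "ereal (r - real i / real e) < min (ord_qp (coeff h i)) (ord_qp (- (?p * coeff h (i + e))))"
        using gt gt' by simp
      also have "\<dots> \<le> ord_qp (coeff h i + - (?p * coeff h (i + e)))"
        by (rule qp.v_add) auto
      finally show ?thesis using True by (simp add: c)
    qed (simp add: c0)
  qed
qed

lemma valuation_val: "valuation_on (Omega \<pi>) val"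
  unfolding valuation_on_def
proof (intro conjI ballI)
  fix x y assume x: "x \<in> Omega \<pi>" and y: "y \<in> Omega \<pi>"
  show "val x \<noteq> -\<infinity>" "(val x = \<infinity>) = (x = 0)" by (auto simp: val_def)
  show "val (x * y) = val x + val y"
  proof (cases "x = 0 \<or> y = 0")
    case True
    then show ?thesis by (auto simp: val_def)
  next
    case False
    then have nz: "x \<noteq> 0" "y \<noteq> 0" by auto
    obtain f i r where f: "degree f < e" "x = eval f" "dominant f i r"
      using x nz(1) by (rule Omega_nonzero_cases)
    obtain g j s where g: "degree g < e" "y = eval g" "dominant g j s"
      using y nz(2) by (rule Omega_nonzero_cases)
    have "degree (f * g) < 2 * e" using degree_mult_le[of f g] f(1) g(1) by simp
    then obtain h k where "degree h < e" "eval h = eval (f * g)" "dominant h k (r + s)"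
      using dominant_mult[OF f(3) g(3)] by (rule dominant_reduce)
    then have "val (x * y) = ereal (r + s)" using val_eval f(2) g(2) by (metis eval_mult)
    then show ?thesis using val_eval f g by simp
  qed
  show "min (val x) (val y) \<le> val (x + y)"
  proof (cases "x = 0 \<or> y = 0")
    case False
    obtain f where f: "degree f < e" "x = eval f" using x by (rule Omega_cases)
    obtain g where g: "degree g < e" "y = eval g" using y by (rule Omega_cases)
    have fg: "degree (f + g) < e" using f g degree_add_less by blast
    obtain a c where "val x = ereal a" "val y = ereal c"
      using False by (simp add: val_def)
    then obtain s where s: "min (val x) (val y) = ereal s" by (metis min_def)
    then have "ereal s \<le> val x" "ereal s \<le> val y"
      by (metis min.cobounded1, metis min.cobounded2)
    then have "ereal s \<le> val (eval (f + g))"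
      unfolding f(2) g(2) val_eval_ge_iff[OF f(1)] val_eval_ge_iff[OF g(1)] val_eval_ge_iff[OF fg]
      by (auto intro: qp.v_add_ge)
    then show ?thesis using s f g by simp
  qed (auto simp: val_def)
qed

lemma to_ac_in_Omega: "to_ac a \<in> Omega \<pi>" and pi_in_Omega: "\<pi> \<in> Omega \<pi>"
proof -
  have "to_ac a = eval [:a:]" "\<pi> = eval (monom 1 1)" by simp_all
  then show "to_ac a \<in> Omega \<pi>" "\<pi> \<in> Omega \<pi>"
    unfolding Omega_eq_range_eval by (metis rangeI)+
qed

lemma val_to_ac: "val (to_ac a) = ord_qp a"
proof (cases "a = 0")
  case False
  then obtain k where k: "ord_qp a = ereal (of_int k)" using ord_qp_nonzero by blast
  have "dominant [:a:] 0 (of_int k)"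
    using k by (auto simp: dominant_def coeff_pCons split: nat.splits)
  moreover have "degree [:a:] < e" using e_pos by simp
  ultimately have "val (eval [:a:]) = ereal (of_int k)" by (intro val_eval)
  then show ?thesis using k by simp
qed (simp add: val_def)

lemma Omega_subring:
  "0 \<in> Omega \<pi>" "1 \<in> Omega \<pi>" "x \<in> Omega \<pi> \<Longrightarrow> y \<in> Omega \<pi> \<Longrightarrow> x + y \<in> Omega \<pi>"
  "x \<in> Omega \<pi> \<Longrightarrow> y \<in> Omega \<pi> \<Longrightarrow> x * y \<in> Omega \<pi>" "x \<in> Omega \<pi> \<Longrightarrow> - x \<in> Omega \<pi>"
  unfolding Omega_eq_range_eval
  by (force simp flip: eval_0 eval_1 eval_add eval_mult eval_minus)+

text \<open>The equation \<open>\<pi> ^ e = - p\<close> forces the order of \<open>\<pi>\<close>.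
  The dominant term of the reduced representative then forces the order of every other
  element.\<close>

lemma valuation_unique:
  assumes v: "valuation_on (Omega \<pi>) v" and ext: "\<And>a. v (to_ac a) = ord_qp a"
  shows "v \<pi> = ereal (1 / real e)" and "x \<in> Omega \<pi> \<Longrightarrow> v x = val x"
proof -
  interpret valued_subring "Omega \<pi>" v
    by unfold_locales (use Omega_subring v in auto)
  have "\<pi> \<noteq> 0"
  proof
    assume "\<pi> = 0"
    then have "to_ac (of_nat CARD('p) :: 'p qp) = 0" using pi_power e_pos by (simp add: zero_power)
    then show False by (simp only: to_ac_eq_0_iff of_nat_CARD_qp_neq_0)
  qed
  then obtain t where t: "v \<pi> = ereal t" using v_finite pi_in_Omega by blast
  have "v (\<pi> ^ e) = 1"
    using ext[of "- of_nat CARD('p)"] by (simp add: pi_power ord_qp_CARD)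
  then have "real e * t = 1" using v_power[OF pi_in_Omega t, of e] by (simp add: one_ereal_def)
  then show pi: "v \<pi> = ereal (1 / real e)" using t e_pos by (simp add: field_simps)
  assume x: "x \<in> Omega \<pi>"
  show "v x = val x"
  proof (cases "x = 0")
    case False
    obtain f i r where f: "degree f < e" "x = eval f" "dominant f i r"
      using x False by (rule Omega_nonzero_cases)
    have vt: "v (to_ac (coeff f j) * \<pi> ^ j) = ord_qp (coeff f j) + ereal (real j / real e)" for j
      using v_power[OF pi_in_Omega pi, of j] by (simp add: v_mult to_ac_in_Omega pi_in_Omega ext)
    have i: "v (to_ac (coeff f i) * \<pi> ^ i) = ereal r" using f(3) by (simp add: vt dominant_def)
    have j: "ereal r < v (to_ac (coeff f j) * \<pi> ^ j)" if "j \<noteq> i" for j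
    proof -
      have "ereal (r - real j / real e) < ord_qp (coeff f j)" using f(3) that by (simp add: dominant_def)
      then show ?thesis unfolding vt by (cases "ord_qp (coeff f j)") auto
    qed
    have "v x = v (to_ac (coeff f i) * \<pi> ^ i)"
      unfolding f(2) eval_altdef
      by (rule v_sum_eq_dominant)
        (use i j dominant_nonzero[OF f(3)] \<open>\<pi> \<noteq> 0\<close> in \<open>auto simp: to_ac_in_Omega pi_in_Omega intro: le_degree\<close>)
    then show ?thesis using i val_eval[OF f(1,3)] f(2) by simp
  qed (simp add: val_def)
qed

lemma ord_ext_Omega:
  "x \<in> Omega \<pi> \<Longrightarrow> ord_ext (Omega \<pi>) x = val x"
proof -
  assume x: "x \<in> Omega \<pi>"
  \<comment> \<open>The restriction is essential: \<open>ord_ext\<close> asks for an extensional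
    function, and \<open>val\<close> is not one.\<close>
  have "ord_ext (Omega \<pi>) = restrict val (Omega \<pi>)"
    unfolding ord_ext_def
  proof (rule the_equality)
    show "restrict val (Omega \<pi>) \<in> extensional (Omega \<pi>) \<and>
        valuation_on (Omega \<pi>) (restrict val (Omega \<pi>)) \<and>
        (\<forall>x. restrict val (Omega \<pi>) (to_ac x) = ord_qp x)"
      using valuation_val Omega_subring
      by (simp add: to_ac_in_Omega val_to_ac valuation_on_def)
  next
    fix v assume v: "v \<in> extensional (Omega \<pi>) \<and> valuation_on (Omega \<pi>) v \<and>
        (\<forall>x. v (to_ac x) = ord_qp x)"
    then show "v = restrict val (Omega \<pi>)"
      using valuation_unique(2)[of v]
      by (intro extensionalityI[of v "Omega \<pi>"]) auto
  qed
  then show ?thesis using x by simp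
qed

lemma complete_valued_Omega: "complete_valued_subring (Omega \<pi>) (ord_ext (Omega \<pi>))"
proof -
  interpret valued_subring "Omega \<pi>" "ord_ext (Omega \<pi>)"
    using Omega_subring valuation_val
    by unfold_locales (auto simp: valuation_on_def ord_ext_Omega)
  show ?thesis
  proof
    fix y assume y: "\<And>n. y n \<in> Omega \<pi>"
      and cau: "((\<lambda>n. ord_ext (Omega \<pi>) (y (Suc n) - y n)) \<longlongrightarrow> \<infinity>) sequentially"
    have "\<forall>n. \<exists>f. degree f < e \<and> y n = eval f"
      using y Omega_cases by metis
    then obtain f where f: "\<And>n. degree (f n) < e" "\<And>n. y n = eval (f n)" by metis
    have d: "degree (f m - f n) < e" for m n using degree_diff_less f(1) by blast
    have "\<exists>s. ((\<lambda>n. ord_qp (s - coeff (f n) i)) \<longlongrightarrow> \<infinity>) sequentially" for i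
    proof -
      have "((\<lambda>n. ord_qp (coeff (f (Suc n)) i - coeff (f n) i)) \<longlongrightarrow> \<infinity>) sequentially"
        unfolding tendsto_PInfty
      proof
        \<comment> \<open>The summand \<open>i / e\<close> undoes the weight of index
          \<open>i\<close> in \<open>val_eval_ge_iff\<close>; the summand 1 turns the resulting weak
          bound into a strict one.\<close>
        fix r
        have "\<forall>\<^sub>F n in sequentially. ereal (r + 1 + real i / real e) < ord_ext (Omega \<pi>) (y (Suc n) - y n)"
          using cau unfolding tendsto_PInfty by blast
        then show "\<forall>\<^sub>F n in sequentially. ereal r < ord_qp (coeff (f (Suc n)) i - coeff (f n) i)"
        proof eventually_elim
          case (elim n)
          then have "ereal (r + 1 + real i / real e) \<le> val (eval (f (Suc n) - f n))"
            using y f(2) ord_ext_Omega[of "y (Suc n) - y n"] by simp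
          then have "ereal (r + 1) \<le> ord_qp (coeff (f (Suc n)) i - coeff (f n) i)"
            unfolding val_eval_ge_iff[OF d] by (auto dest: spec[of _ i])
          then show ?case by (rule order_less_le_trans[rotated]) simp
        qed
      qed
      then show ?thesis using qp.complete[of "\<lambda>n. coeff (f n) i"] by simp
    qed
    then obtain s where s: "\<And>i. ((\<lambda>n. ord_qp (s i - coeff (f n) i)) \<longlongrightarrow> \<infinity>) sequentially" by metis
    define g where "g = (\<Sum>i<e. monom (s i) i)"
    have cg: "coeff g i = (if i < e then s i else 0)" for i
      by (simp add: g_def coeff_sum)
    have dg: "degree g < e"
    proof -
      have "degree g \<le> e - 1" by (rule degree_le) (auto simp: cg)
      then show ?thesis using e_pos by simp
    qed
    have eg: "eval g \<in> Omega \<pi>" by (simp add: Omega_eq_range_eval)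
    have "((\<lambda>n. ord_ext (Omega \<pi>) (eval g - y n)) \<longlongrightarrow> \<infinity>) sequentially"
      unfolding tendsto_PInfty
    proof
      \<comment> \<open>Only the finitely many indices below \<open>e\<close> occur, so the bounds
        eventually hold simultaneously.\<close>
      fix r
      have "\<forall>\<^sub>F n in sequentially. \<forall>i\<in>{..<e}. ereal (r + 1 - real i / real e) < ord_qp (s i - coeff (f n) i)"
        using s unfolding tendsto_PInfty by (intro eventually_ball_finite) auto
      then show "\<forall>\<^sub>F n in sequentially. ereal r < ord_ext (Omega \<pi>) (eval g - y n)"
      proof eventually_elim
        case (elim n)
        have dd: "degree (g - f n) < e" using degree_diff_less dg f(1) by blast
        have "ereal (r + 1 - real i / real e) \<le> ord_qp (coeff (g - f n) i)" for i
        proof (cases "i < e")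
          case True
          then show ?thesis using elim by (auto simp: cg intro: less_imp_le)
        next
          case False
          then have "coeff (f n) i = 0" using f(1)[of n] by (intro coeff_eq_0) simp
          then show ?thesis using False by (simp add: cg)
        qed
        then have "ereal (r + 1) \<le> val (eval (g - f n))" unfolding val_eval_ge_iff[OF dd] by blast
        then have "ereal (r + 1) \<le> ord_ext (Omega \<pi>) (eval g - y n)"
          using f(2) ord_ext_Omega[of "eval g - y n"] eg y by simp
        then show ?case by (rule order_less_le_trans[rotated]) simp
      qed
    qed
    then show "\<exists>s\<in>Omega \<pi>. ((\<lambda>n. ord_ext (Omega \<pi>) (s - y n)) \<longlongrightarrow> \<infinity>) sequentially"
      using eg by blast
  qed
qed

lemma ord_ext_to_ac: "ord_ext (Omega \<pi>) (to_ac a) = ord_qp a"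
  by (simp add: ord_ext_Omega to_ac_in_Omega val_to_ac)

lemma ord_ext_pi: "ord_ext (Omega \<pi>) \<pi> = ereal (1 / real e)"
  using valuation_unique(1)[OF valuation_val val_to_ac] by (simp add: ord_ext_Omega pi_in_Omega)

end

section \<open>The equation on coefficients\<close>

lemma scale_nth [simp]: "fps_nth (fps_nth (scale c f) n) m = c * fps_nth (fps_nth f n) m"
  by (simp add: scale_def)

lemma scale_add: "scale c (f + g) = scale c f + scale c g"
  by (simp add: scale_def distrib_left)

lemma scale_minus_1: "scale (- 1) f = - f"
  by (simp add: fps_eq_iff)

lemma wseries_nth [simp]: "fps_nth (fps_nth (wseries \<kappa> A) n) m = A n m * falling \<kappa> m"
  by (simp add: wseries_def)

lemma wseries_add: "wseries \<kappa> A + wseries \<kappa> B = wseries \<kappa> (\<lambda>n m. A n m + B n m)"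
  by (simp add: fps_eq_iff algebra_simps)

lemma wseries_scale: "scale c (wseries \<kappa> A) = wseries \<kappa> (\<lambda>n m. c * A n m)"
  by (simp add: fps_eq_iff)

lemma wseries_0: "wseries \<kappa> (\<lambda>n m. 0) = 0"
  by (simp add: fps_eq_iff)

lemma monomial_nth:
  "fps_nth (fps_nth (fps_X ^ i * wfall \<kappa> j) n) k = (if n = i \<and> k = j then falling \<kappa> k else 0)"
proof -
  have "wfall \<kappa> j = fps_const (fps_const (falling \<kappa> j) * fps_X ^ j)"
    by (simp add: wfall_def scale_def)
  then show ?thesis
    by (auto simp: fps_X_power_mult_nth fps_mult_left_const_nth)
qed

text \<open>A complement of \<open>N\<close> represents each coset exactly once. The assumption on
  \<open>- 1\<close> supplies differences, as \<open>is_submodule\<close> speaks of sums and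
  scalings only.\<close>

lemma internal_direct_sum_imp_quotient_iso:
  assumes ds: "internal_direct_sum K M V N" and m1: "- 1 \<in> K"
  shows "quotient_iso K M N V (add_coset N)"
proof -
  have sub: "is_submodule K M" "is_submodule K V" "is_submodule K N"
    and M: "M = {f + g | f g. f \<in> V \<and> g \<in> N}" and int: "V \<inter> N = {0}"
    using ds by (auto simp: internal_direct_sum_def)
  have diff: "f - g \<in> W" if "is_submodule K W" "f \<in> W" "g \<in> W" for f g W
  proof -
    have "f + scale (- 1) g \<in> W" using that m1 by (auto simp: is_submodule_def)
    then show ?thesis by (simp add: scale_minus_1)
  qed
  have N0: "0 \<in> N" and Nadd: "\<And>f g. f \<in> N \<Longrightarrow> g \<in> N \<Longrightarrow> f + g \<in> N"
    and Nscale: "\<And>c f. c \<in> K \<Longrightarrow> f \<in> N \<Longrightarrow> scale c f \<in> N"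
    using sub(3) by (auto simp: is_submodule_def)
  have V0: "0 \<in> V" using sub(2) by (auto simp: is_submodule_def)
  have mem: "h \<in> add_coset N f \<longleftrightarrow> h - f \<in> N" for h f
  proof
    assume "h - f \<in> N"
    moreover have "h = f + (h - f)" by simp
    ultimately show "h \<in> add_coset N f" unfolding add_coset_def by blast
  qed (auto simp: add_coset_def)
  have "N \<subseteq> M" unfolding M using V0 by force
  moreover have "bij_betw (add_coset N) V (quotient_space M N)"
    unfolding bij_betw_def
  proof
    show "inj_on (add_coset N) V"
    proof (rule inj_onI)
      fix f g assume fg: "f \<in> V" "g \<in> V" "add_coset N f = add_coset N g"
      have "f \<in> add_coset N g" using mem[of f f] fg(3) N0 by simp
      then have "f - g \<in> V \<inter> N" using mem diff[OF sub(2) fg(1,2)] by simp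
      then show "f = g" using int by simp
    qed
    have "add_coset N (f + g) = add_coset N f" if "g \<in> N" for f g
    proof (rule Set.set_eqI)
      fix h
      have "h - (f + g) \<in> N \<longleftrightarrow> h - f \<in> N"
        using diff[OF sub(3), of "h - f" g] Nadd[of "h - (f + g)" g] that by (auto simp: algebra_simps)
      then show "h \<in> add_coset N (f + g) \<longleftrightarrow> h \<in> add_coset N f" by (simp add: mem)
    qed
    moreover have "f \<in> M" if "f \<in> V" for f unfolding M using N0 that by force
    ultimately show "add_coset N ` V = quotient_space M N"
      unfolding quotient_space_def by (auto simp: M image_iff)
  qed
  moreover have "add_coset N (f + g) = coset_add (add_coset N f) (add_coset N g)" for f g
  proof (intro Set.set_eqI iffI)
    fix h assume "h \<in> add_coset N (f + g)"
    then obtain k where k: "k \<in> N" "h = (f + k) + (g + 0)"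
      by (auto simp: add_coset_def algebra_simps)
    then show "h \<in> coset_add (add_coset N f) (add_coset N g)"
      unfolding coset_add_def add_coset_def using N0 by blast
  next
    fix h assume "h \<in> coset_add (add_coset N f) (add_coset N g)"
    then obtain k l where "k \<in> N" "l \<in> N" "h = (f + k) + (g + l)"
      by (auto simp: coset_add_def add_coset_def)
    then have "k + l \<in> N" "h = (f + g) + (k + l)" using Nadd by (auto simp: algebra_simps)
    then show "h \<in> add_coset N (f + g)" unfolding add_coset_def by blast
  qed
  moreover have "add_coset N (scale c f) = coset_scale N c (add_coset N f)" if "c \<in> K" for c f
  proof (intro Set.set_eqI iffI)
    fix h assume "h \<in> add_coset N (scale c f)"
    then obtain k where k: "k \<in> N" "h = scale c (f + 0) + k" by (auto simp: add_coset_def)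
    then show "h \<in> coset_scale N c (add_coset N f)"
      unfolding coset_scale_def add_coset_def using N0 by blast
  next
    fix h assume "h \<in> coset_scale N c (add_coset N f)"
    then obtain k l where "k \<in> N" "l \<in> N" "h = scale c (f + k) + l"
      by (auto simp: coset_scale_def add_coset_def)
    then have "scale c k + l \<in> N" "h = scale c f + (scale c k + l)"
      using Nadd Nscale that by (auto simp: scale_add algebra_simps)
    then show "h \<in> add_coset N (scale c f)" unfolding add_coset_def by blast
  qed
  ultimately show ?thesis using sub by (simp add: quotient_iso_def)
qed

text \<open>Isolates what the analysis uses: \<open>c\<close> is the order of \<open>\<pi>\<close>,
  \<open>v_kappa\<close> keeps the factors of the operator integral, and
  \<open>kappa_not_nat\<close> lets a series determine its coefficients.\<close>

locale dwork_series = complete_valued_subring K v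
  for K :: "'a::field set" and v :: "'a \<Rightarrow> ereal" +
  fixes \<pi> \<kappa> :: 'a and c b' \<epsilon> :: real
  assumes pi_closed [simp]: "\<pi> \<in> K" and v_pi: "v \<pi> = ereal c"
    and kappa_closed [simp]: "\<kappa> \<in> K" and v_kappa: "0 \<le> v \<kappa>" and kappa_not_nat: "\<kappa> \<notin> \<nat>"
    and eps_pos: "\<epsilon> > 0" and b'_le: "b' \<le> \<epsilon> + c"
begin

section \<open>The operator on coefficient arrays\<close>

definition bounded :: "real \<Rightarrow> (nat \<Rightarrow> nat \<Rightarrow> 'a) \<Rightarrow> bool" where
  "bounded \<rho> A \<longleftrightarrow> (\<forall>n m. A n m \<in> K \<and> ereal (2 * b' * real n + \<epsilon> * real m + \<rho>) \<le> v (A n m))"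

text \<open>The factor of the third term of \<open>del_mono\<close> taken at \<open>m + 1\<close>,
  the index from which that term lands on \<open>m\<close>.\<close>

definition lower :: "nat \<Rightarrow> 'a" where
  "lower m = of_nat (m + 1) * (\<kappa> - of_nat m) * \<pi>\<^sup>2"

text \<open>The operator collected by target monomial instead of source monomial;
  \<open>del_wseries\<close> proves the agreement.\<close>

definition dcoeff :: "(nat \<Rightarrow> nat \<Rightarrow> 'a) \<Rightarrow> nat \<Rightarrow> nat \<Rightarrow> 'a" where
  "dcoeff A n m = of_nat n * A n m + (if m = 0 then 0 else A n (m - 1)) +
     (if n = 0 then 0 else lower m * A (n - 1) (m + 1))"

lemma boundedD:
  assumes "bounded \<rho> A"
  shows "A n m \<in> K" and "ereal (2 * b' * real n + \<epsilon> * real m + \<rho>) \<le> v (A n m)"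
  using assms by (auto simp: bounded_def)

lemma bounded_mono: "bounded \<rho> A \<Longrightarrow> \<sigma> \<le> \<rho> \<Longrightarrow> bounded \<sigma> A"
  unfolding bounded_def by (meson add_left_mono ereal_less_eq(3) order_trans)

lemma bounded_0: "bounded \<rho> (\<lambda>n m. 0)"
  by (simp add: bounded_def)

lemma bounded_add: "bounded \<rho> A \<Longrightarrow> bounded \<rho> B \<Longrightarrow> bounded \<rho> (\<lambda>n m. A n m + B n m)"
  by (simp add: bounded_def v_add_ge)

lemma bounded_diff: "bounded \<rho> A \<Longrightarrow> bounded \<rho> B \<Longrightarrow> bounded \<rho> (\<lambda>n m. A n m - B n m)"
  by (simp add: bounded_def v_diff_ge)

lemma bounded_scale:
  assumes "x \<in> K" "ereal t \<le> v x" "bounded \<rho> A"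
  shows "bounded (t + \<rho>) (\<lambda>n m. x * A n m)"
  unfolding bounded_def
proof (intro allI conjI)
  fix n m
  show "x * A n m \<in> K" using assms boundedD(1)[OF assms(3)] by simp
  show "ereal (2 * b' * real n + \<epsilon> * real m + (t + \<rho>)) \<le> v (x * A n m)"
    using v_mult_ge[OF assms(1) boundedD(1)[OF assms(3)] assms(2) boundedD(2)[OF assms(3)], of n m]
    by (simp add: algebra_simps)
qed

lemma lower_closed [simp]: "lower m \<in> K"
  by (simp add: lower_def)

lemma v_lower: "ereal (2 * c) \<le> v (lower m)"
proof -
  have "v (\<pi>\<^sup>2) = ereal (2 * c)" using v_power[OF pi_closed v_pi, of 2] by simp
  moreover have "0 \<le> v (\<kappa> - of_nat m)" using v_kappa by (simp add: v_diff_ge)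
  then have "0 \<le> v (of_nat (m + 1) * (\<kappa> - of_nat m))"
    unfolding zero_ereal_def
    by (intro v_mult_integral_ge) (auto simp flip: zero_ereal_def of_nat_Suc simp del: of_nat_Suc)
  ultimately show ?thesis unfolding lower_def by (intro v_mult_integral_ge) auto
qed

text \<open>The loss of \<open>2 * b'\<close> in the exponent of \<open>t\<close> is compensated by \<open>\<pi>\<^sup>2\<close>, because \<open>b' \<le> \<epsilon> + c\<close>.\<close>

lemma v_lower_mult:
  assumes "x \<in> K" and "ereal (2 * b' * real n + \<epsilon> * real (m + 1) + \<rho>) \<le> v x"
  shows "ereal (2 * b' * real (n + 1) + \<epsilon> * real m + \<rho> - \<epsilon>) \<le> v (lower m * x)"
proof -
  have "2 * b' * real (n + 1) + \<epsilon> * real m + \<rho> - \<epsilon>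
      \<le> 2 * c + (2 * b' * real n + \<epsilon> * real (m + 1) + \<rho>)"
    using b'_le by (simp add: algebra_simps)
  then show ?thesis
    using v_mult_ge[OF lower_closed assms(1) v_lower assms(2)] by (meson ereal_less_eq(3) order_trans)
qed

text \<open>Multiplication by \<open>n\<close> costs nothing, raising the index of \<open>w\<close>
  costs exactly \<open>\<epsilon>\<close>, and the term with \<open>lower\<close> costs at most
  \<open>\<epsilon>\<close> by \<open>v_lower_mult\<close>.\<close>

lemma bounded_dcoeff:
  assumes A: "bounded (\<rho> + \<epsilon>) A" shows "bounded \<rho> (dcoeff A)"
  unfolding bounded_def
proof (intro allI conjI)
  fix n m
  note Ac = boundedD(1)[OF A] and Av = boundedD(2)[OF A]
  show "dcoeff A n m \<in> K" by (simp add: dcoeff_def Ac)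
  let ?r = "2 * b' * real n + \<epsilon> * real m + \<rho>"
  have "ereal ?r \<le> v (of_nat n * A n m)"
    using Av[of n m] eps_pos
    by (intro v_mult_integral_ge) (auto simp: Ac intro: order_trans[rotated])
  moreover have "ereal ?r \<le> v (if m = 0 then 0 else A n (m - 1))"
    using Av[of n "m - 1"] by (cases m) (auto simp: algebra_simps)
  moreover have "ereal ?r \<le> v (if n = 0 then 0 else lower m * A (n - 1) (m + 1))"
    using v_lower_mult[OF Ac Av[of "n - 1" "m + 1"]] by (cases n) (auto simp: algebra_simps)
  ultimately show "ereal ?r \<le> v (dcoeff A n m)"
    unfolding dcoeff_def by (intro v_add_ge) (auto simp: Ac)
qed

text \<open>The way identities between limits are proved here: their defect has arbitrarily large
  order.\<close>

lemma v_eq_infinityI: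
  assumes "x \<in> K" "\<And>r. ereal r < v x" shows "x = 0"
  using assms v_finite[of x] by (metis less_irrefl)

text \<open>The solution is \<open>A(m) = \<Sum>\<^sub>i (-k)\<^sup>i C(m+i)\<close>.\<close>

lemma solve_row:
  assumes C: "\<And>m. C m \<in> K" "\<And>m. ereal (\<epsilon> * real m + s) \<le> v (C m)"
  shows "\<exists>A. \<forall>m. A m \<in> K \<and> ereal (\<epsilon> * real m + s) \<le> v (A m) \<and> A m = C m - of_nat k * A (Suc m)"
proof -
  define y where "y m n = (\<Sum>i<n. (- of_nat k) ^ i * C (m + i))" for m n
  have term_ge: "ereal (\<epsilon> * real (m + i) + s) \<le> v ((- of_nat k) ^ i * C (m + i))" for m i
  proof (rule v_mult_integral_ge)
    show "0 \<le> v ((- of_nat k) ^ i)"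
    proof (induction i)
      case (Suc i)
      have "ereal 0 \<le> v (- of_nat k * (- of_nat k) ^ i)"
        using Suc by (intro v_mult_integral_ge) (auto simp: zero_ereal_def[symmetric])
      then show ?case by (simp add: zero_ereal_def)
    qed simp
    show "ereal (\<epsilon> * real (m + i) + s) \<le> v (C (m + i))" by (rule C)
  qed (use C in auto)
  have yc [simp]: "y m n \<in> K" for m n by (simp add: y_def C)
  have y_ge: "ereal (\<epsilon> * real m + s) \<le> v (y m n)" for m n
    unfolding y_def
  proof (rule v_sum_ge)
    fix i
    have "ereal (\<epsilon> * real m + s) \<le> ereal (\<epsilon> * real (m + i) + s)" using eps_pos by simp
    from order_trans[OF this term_ge]
    show "(- of_nat k) ^ i * C (m + i) \<in> K \<and>
        ereal (\<epsilon> * real m + s) \<le> v ((- of_nat k) ^ i * C (m + i))"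
      by (simp add: C)
  qed
  \<comment> \<open>The partial sums satisfy the equation up to a shift of \<open>n\<close>, which
    disappears in the limit.\<close>
  have y_Suc: "y m (Suc n) = C m - of_nat k * y (Suc m) n" for m n
    by (simp add: y_def sum.lessThan_Suc_shift sum_distrib_left sum_negf mult.assoc del: sum.lessThan_Suc)
  have "\<exists>a\<in>K. ((\<lambda>n. v (a - y m n)) \<longlongrightarrow> \<infinity>) sequentially" for m
  proof (rule complete)
    show "((\<lambda>n. v (y m (Suc n) - y m n)) \<longlongrightarrow> \<infinity>) sequentially"
      unfolding tendsto_PInfty
    proof
      fix r
      \<comment> \<open>If \<open>k\<close> is prime to \<open>p\<close> its powers do not decay;
        the bound on \<open>C (m + n)\<close> makes the terms tend to 0.\<close>
      obtain N :: nat where N: "r - s < real N * \<epsilon>" using ex_less_of_nat_mult[OF eps_pos] by blast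
      have "ereal r < v (y m (Suc n) - y m n)" if "n \<ge> N" for n
      proof -
        have "real N * \<epsilon> \<le> real (m + n) * \<epsilon>" using that eps_pos by (intro mult_right_mono) auto
        then have "ereal r < ereal (\<epsilon> * real (m + n) + s)" using N by (simp add: mult.commute)
        also have "\<dots> \<le> v ((- of_nat k) ^ n * C (m + n))" by (rule term_ge)
        also have "(- of_nat k) ^ n * C (m + n) = y m (Suc n) - y m n" by (simp add: y_def)
        finally show ?thesis .
      qed
      then show "\<forall>\<^sub>F n in sequentially. ereal r < v (y m (Suc n) - y m n)"
        by (auto simp: eventually_sequentially)
    qed
  qed simp
  then obtain A where Ac [simp]: "\<And>m. A m \<in> K"
    and lim: "\<And>m. ((\<lambda>n. v (A m - y m n)) \<longlongrightarrow> \<infinity>) sequentially" by metis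
  have "ereal (\<epsilon> * real m + s) \<le> v (A m)" for m
  proof -
    have "\<forall>\<^sub>F n in sequentially. ereal (\<epsilon> * real m + s) < v (A m - y m n)"
      using lim[of m] unfolding tendsto_PInfty by blast
    then obtain n where "ereal (\<epsilon> * real m + s) < v (A m - y m n)"
      by (auto simp: eventually_sequentially)
    then have "ereal (\<epsilon> * real m + s) \<le> v ((A m - y m n) + y m n)"
      using y_ge by (intro v_add_ge) auto
    then show ?thesis by simp
  qed
  moreover have "A m - C m + of_nat k * A (Suc m) = 0" for m
  proof (rule v_eq_infinityI)
    fix r
    have "\<forall>\<^sub>F n in sequentially. ereal (r + 1) < v (A m - y m (Suc n))"
      using lim[of m, THEN LIMSEQ_Suc] unfolding tendsto_PInfty by blast
    moreover have "\<forall>\<^sub>F n in sequentially. ereal (r + 1) < v (A (Suc m) - y (Suc m) n)"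
      using lim[of "Suc m"] unfolding tendsto_PInfty by blast
    ultimately have "\<forall>\<^sub>F n in sequentially. ereal r < v (A m - C m + of_nat k * A (Suc m))"
    proof eventually_elim
      case (elim n)
      have "ereal (r + 1) \<le> v ((A m - y m (Suc n)) + of_nat k * (A (Suc m) - y (Suc m) n))"
        using elim by (intro v_add_ge v_mult_integral_ge) auto
      also have "(A m - y m (Suc n)) + of_nat k * (A (Suc m) - y (Suc m) n)
          = A m - C m + of_nat k * A (Suc m)"
        by (simp add: y_Suc algebra_simps)
      finally show ?case by (rule order_less_le_trans[rotated]) simp
    qed
    then show "ereal r < v (A m - C m + of_nat k * A (Suc m))" by simp
  qed (simp add: C)
  ultimately show ?thesis by (intro exI[of _ A]) (auto simp: algebra_simps)
qed

text \<open>The equations at index 0 are left out: their defect is the component in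
  \<open>R\<close>. Since \<open>A n m\<close> is governed by \<open>B n (Suc m)\<close>, it
  inherits the extra \<open>\<epsilon>\<close>.\<close>

lemma dcoeff_solvable:
  assumes B: "bounded \<rho> B"
  shows "\<exists>A. bounded (\<rho> + \<epsilon>) A \<and> (\<forall>n m. dcoeff A n (Suc m) = B n (Suc m))"
proof -
  note Bc = boundedD(1)[OF B] and Bv = boundedD(2)[OF B]
  \<comment> \<open>Set up for dependent choice of rows: \<open>P\<close> carries the bounds and
    fixes row 0, where the equation is explicit, and \<open>Q\<close> links row \<open>Suc n\<close>
    to row \<open>n\<close>.\<close>
  define P where "P n x \<longleftrightarrow> (\<forall>m. x m \<in> K \<and> ereal (2 * b' * real n + \<epsilon> * real m + (\<rho> + \<epsilon>)) \<le> v (x m))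
    \<and> (n = 0 \<longrightarrow> (\<forall>m. x m = B 0 (Suc m)))" for n :: nat and x
  define Q where "Q n x y \<longleftrightarrow>
    (\<forall>m. y m = B (Suc n) (Suc m) - lower (Suc m) * x (m + 2) - of_nat (Suc n) * y (Suc m))"
    for n :: nat and x y
  have "P 0 (\<lambda>m. B 0 (Suc m))"
    using Bv[of 0 "Suc m" for m] by (auto simp: P_def Bc algebra_simps)
  then have base: "\<exists>x. P 0 x" by blast
  have step: "\<exists>y. P (Suc n) y \<and> Q n x y" if x: "P n x" for n x
  proof -
    have xc: "x m \<in> K" and xv: "ereal (2 * b' * real n + \<epsilon> * real m + (\<rho> + \<epsilon>)) \<le> v (x m)" for m
      using x by (auto simp: P_def)
    let ?s = "2 * b' * real (Suc n) + \<rho> + \<epsilon>"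
    have "\<exists>y. \<forall>m. y m \<in> K \<and> ereal (\<epsilon> * real m + ?s) \<le> v (y m) \<and>
      y m = (B (Suc n) (Suc m) - lower (Suc m) * x (m + 2)) - of_nat (Suc n) * y (Suc m)"
    proof (rule solve_row)
      fix m
      show "B (Suc n) (Suc m) - lower (Suc m) * x (m + 2) \<in> K" by (simp add: Bc xc)
      have "ereal (2 * b' * real n + \<epsilon> * real (Suc m + 1) + (\<rho> + \<epsilon>)) \<le> v (x (m + 2))"
        using xv[of "m + 2"] by simp
      from v_lower_mult[OF xc this]
      have "ereal (\<epsilon> * real m + ?s) \<le> v (lower (Suc m) * x (m + 2))"
        by (simp add: algebra_simps)
      moreover have "ereal (\<epsilon> * real m + ?s) \<le> v (B (Suc n) (Suc m))"
        using Bv[of "Suc n" "Suc m"] by (simp add: algebra_simps)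
      ultimately show "ereal (\<epsilon> * real m + ?s) \<le> v (B (Suc n) (Suc m) - lower (Suc m) * x (m + 2))"
        by (intro v_diff_ge) (auto simp: Bc xc)
    qed
    then obtain y where y: "\<And>m. y m \<in> K" "\<And>m. ereal (\<epsilon> * real m + ?s) \<le> v (y m)"
      "\<And>m. y m = (B (Suc n) (Suc m) - lower (Suc m) * x (m + 2)) - of_nat (Suc n) * y (Suc m)"
      by metis
    have "2 * b' * real (Suc n) + \<epsilon> * real m + (\<rho> + \<epsilon>) = \<epsilon> * real m + ?s" for m by simp
    then have "P (Suc n) y" using y(1,2) by (simp only: P_def) simp
    moreover have "Q n x y" using y(3) unfolding Q_def by blast
    ultimately show ?thesis by blast
  qed
  obtain A where A: "\<And>n. P n (A n)" "\<And>n. Q n (A n) (A (Suc n))"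
    using dependent_nat_choice[of P Q, OF base step] by blast
  have "bounded (\<rho> + \<epsilon>) A" using A(1) by (auto simp: bounded_def P_def)
  moreover have "dcoeff A n (Suc m) = B n (Suc m)" for n m
  proof (cases n)
    case 0
    then show ?thesis using A(1)[of 0] by (simp add: dcoeff_def P_def)
  next
    case (Suc k)
    have "A (Suc k) m = B (Suc k) (Suc m) - lower (Suc m) * A k (m + 2) - of_nat (Suc k) * A (Suc k) (Suc m)"
      using A(2)[of k] unfolding Q_def by blast
    then show ?thesis using Suc by (simp add: dcoeff_def)
  qed
  ultimately show ?thesis by blast
qed

text \<open>Once row \<open>n\<close> vanishes, row \<open>Suc n\<close> is homogeneous: each entry
  is an integer multiple of the next, hence of entries arbitrarily far out, whose orders grow with
  \<open>\<epsilon>\<close>.\<close>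

lemma dcoeff_injective:
  assumes A: "bounded \<rho> A" and z: "\<And>n m. dcoeff A n (Suc m) = 0"
  shows "A n m = 0"
proof (induction n arbitrary: m)
  case 0
  show ?case using z[of 0 m] by (simp add: dcoeff_def)
next
  case (Suc n)
  note Ac = boundedD(1)[OF A] and Av = boundedD(2)[OF A]
  have rec: "A (Suc n) m = - of_nat (Suc n) * A (Suc n) (Suc m)" for m
    using z[of "Suc n" m] Suc by (simp add: dcoeff_def add_eq_0_iff2 del: of_nat_Suc)
  have ge: "ereal (2 * b' * real (Suc n) + \<epsilon> * real (m + k) + \<rho>) \<le> v (A (Suc n) m)" for m k
  proof (induction k arbitrary: m)
    case 0
    show ?case using Av[of "Suc n" m] by simp
  next
    case (Suc k)
    have "ereal (2 * b' * real (Suc n) + \<epsilon> * real (Suc m + k) + \<rho>)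
        \<le> v (- of_nat (Suc n) * A (Suc n) (Suc m))"
      using Suc[of "Suc m"] by (intro v_mult_integral_ge) (auto simp: Ac simp del: of_nat_Suc)
    then show ?case by (subst rec) simp
  qed
  show ?case
  proof (rule v_eq_infinityI)
    fix r
    obtain k :: nat where k: "r - (2 * b' * real (Suc n) + \<epsilon> * real m + \<rho>) < real k * \<epsilon>"
      using ex_less_of_nat_mult[OF eps_pos] by blast
    then have "ereal r < ereal (2 * b' * real (Suc n) + \<epsilon> * real (m + k) + \<rho>)"
      by (simp add: algebra_simps)
    then show "ereal r < v (A (Suc n) m)" using ge[of m k] by (rule order_less_le_trans)
  qed (rule Ac)
qed

end

section \<open>The direct sum decomposition\<close>

lemma del_mono_nth:
  "fps_nth (fps_nth (del_mono \<pi> \<kappa> i j) n) k =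
    (if n = i \<and> k = j then of_nat i * falling \<kappa> k else 0) +
    (if n = i \<and> k = j + 1 then falling \<kappa> k else 0) +
    (if n = i + 1 \<and> j = k + 1 then of_nat j * (\<kappa> - of_nat j + 1) * \<pi>\<^sup>2 * falling \<kappa> k else 0)"
proof (cases "j = 0")
  case True
  then show ?thesis
    by (simp only: del_mono_def fps_add_nth scale_nth monomial_nth if_True) simp
next
  case False
  \<comment> \<open>With truncated subtraction this fails for \<open>j = 0\<close>, hence the case
    distinction.\<close>
  then have "(k = j - 1) = (j = k + 1)" by auto
  then show ?thesis
    using False by (simp only: del_mono_def fps_add_nth scale_nth monomial_nth if_False) simp
qed

context dwork_series
begin

text \<open>For a natural number \<open>\<kappa>\<close> the monomials with
  \<open>m > \<kappa>\<close> would vanish and their coefficients would be lost.\<close>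

lemma falling_nonzero [simp]: "falling \<kappa> m \<noteq> 0"
  using kappa_not_nat by (auto simp: falling_def)

lemma wseries_eq_iff: "wseries \<kappa> A = wseries \<kappa> B \<longleftrightarrow> A = B"
  by (auto simp: fps_eq_iff fun_eq_iff)

lemma del_wseries: "del \<pi> \<kappa> (wseries \<kappa> A) = wseries \<kappa> (dcoeff A)"
proof -
  have "(\<Sum>i\<le>n. \<Sum>j\<le>k + 1. wcoeff \<kappa> (wseries \<kappa> A) i j * fps_nth (fps_nth (del_mono \<pi> \<kappa> i j) n) k)
      = dcoeff A n k * falling \<kappa> k" for n k
  proof -
    \<comment> \<open>Each contribution is written as a delta in \<open>i\<close> and
      \<open>j\<close>, so that the double sum collapses. The inner tests on \<open>k\<close> and
      \<open>n\<close> remove the spurious hits of \<open>k - 1\<close> and \<open>n - 1\<close> at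
      0.\<close>
    have "wcoeff \<kappa> (wseries \<kappa> A) i j * fps_nth (fps_nth (del_mono \<pi> \<kappa> i j) n) k =
        (if i = n then if j = k then of_nat n * A n k * falling \<kappa> k else 0 else 0) +
        (if i = n then if j = k - 1 then if k = 0 then 0 else A n (k - 1) * falling \<kappa> k else 0 else 0) +
        (if i = n - 1 then if j = k + 1 then if n = 0 then 0
           else lower k * A (n - 1) (k + 1) * falling \<kappa> k else 0 else 0)" for i j
      unfolding del_mono_nth by (cases n; cases k) (auto simp: wcoeff_def lower_def)
    moreover have "(\<Sum>i\<le>n. \<Sum>j\<le>l. if i = a then if j = d then x else 0 else 0)
        = (if a \<le> n \<and> d \<le> l then x else 0)" for a d l :: nat and x :: 'a
    proof -
      have "(\<Sum>j\<le>l. if i = a then if j = d then x else 0 else 0)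
          = (if i = a then if d \<le> l then x else 0 else 0)" for i
        by (simp add: sum.delta)
      then show ?thesis by (simp add: sum.delta)
    qed
    ultimately show ?thesis
      by (simp only: sum.distrib) (auto simp add: dcoeff_def distrib_right)
  qed
  then show ?thesis by (simp add: fps_eq_iff del_def)
qed

lemma dcoeff_add: "dcoeff (\<lambda>n m. A n m + B n m) = (\<lambda>n m. dcoeff A n m + dcoeff B n m)"
  by (auto simp: dcoeff_def fun_eq_iff algebra_simps)

lemma dcoeff_scale: "dcoeff (\<lambda>n m. x * A n m) = (\<lambda>n m. x * dcoeff A n m)"
  by (auto simp: dcoeff_def fun_eq_iff algebra_simps)

lemma dcoeff_0: "dcoeff (\<lambda>n m. 0) = (\<lambda>n m. 0)"
  by (auto simp: dcoeff_def fun_eq_iff)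

section \<open>The spaces \<open>S\<close>, \<open>R\<close> and the image of the operator as
  families in \<open>\<rho>\<close>\<close>

definition Sser :: "real \<Rightarrow> 'a fps fps set" where
  "Sser \<rho> = {wseries \<kappa> A | A. bounded \<rho> A}"

definition Rser :: "real \<Rightarrow> 'a fps fps set" where
  "Rser \<rho> = {wseries \<kappa> A | A. bounded \<rho> A \<and> (\<forall>n m. A n (Suc m) = 0)}"

text \<open>Indexed by the bound that holds after applying the operator, so that the decomposition
  of \<open>Sser\<close> involves a single \<open>\<rho>\<close>.\<close>

definition Dser :: "real \<Rightarrow> 'a fps fps set" where
  "Dser \<rho> = {wseries \<kappa> (dcoeff A) | A. bounded (\<rho> + \<epsilon>) A}"

lemma del_Sser: "del \<pi> \<kappa> ` Sser (\<rho> + \<epsilon>) = Dser \<rho>"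
  by (auto simp: Sser_def Dser_def del_wseries image_iff) (metis del_wseries)

lemma Sser_mono: "\<sigma> \<le> \<rho> \<Longrightarrow> Sser \<rho> \<subseteq> Sser \<sigma>"
  using bounded_mono by (force simp: Sser_def)

lemma Rser_mono: "\<sigma> \<le> \<rho> \<Longrightarrow> Rser \<rho> \<subseteq> Rser \<sigma>"
  using bounded_mono by (force simp: Rser_def)

lemma Dser_mono: "\<sigma> \<le> \<rho> \<Longrightarrow> Dser \<rho> \<subseteq> Dser \<sigma>"
  using bounded_mono[of "\<rho> + \<epsilon>" _ "\<sigma> + \<epsilon>"] by (force simp: Dser_def)

lemma Sser_0: "0 \<in> Sser \<rho>"
  using bounded_0 wseries_0 unfolding Sser_def by force

lemma Rser_0: "0 \<in> Rser \<rho>"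
  using bounded_0 wseries_0 unfolding Rser_def by force

lemma Dser_0: "0 \<in> Dser \<rho>"
proof -
  have "0 = wseries \<kappa> (dcoeff (\<lambda>n m. 0))" by (simp add: dcoeff_0 wseries_0)
  then show ?thesis using bounded_0 unfolding Dser_def by blast
qed

lemma Sser_add:
  assumes "f \<in> Sser \<rho>" "g \<in> Sser \<rho>" shows "f + g \<in> Sser \<rho>"
proof -
  obtain A B where "f = wseries \<kappa> A" "bounded \<rho> A" "g = wseries \<kappa> B" "bounded \<rho> B"
    using assms by (auto simp: Sser_def)
  then show ?thesis using bounded_add by (auto simp: Sser_def wseries_add)
qed

lemma Rser_add:
  assumes "f \<in> Rser \<rho>" "g \<in> Rser \<rho>" shows "f + g \<in> Rser \<rho>"
proof -
  obtain A B where "f = wseries \<kappa> A" "bounded \<rho> A" "\<forall>n m. A n (Suc m) = 0"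
    "g = wseries \<kappa> B" "bounded \<rho> B" "\<forall>n m. B n (Suc m) = 0"
    using assms by (auto simp: Rser_def)
  then show ?thesis using bounded_add[of \<rho> A B]
    by (auto simp: Rser_def wseries_add intro!: exI[of _ "\<lambda>n m. A n m + B n m"])
qed

lemma Dser_add:
  assumes "f \<in> Dser \<rho>" "g \<in> Dser \<rho>" shows "f + g \<in> Dser \<rho>"
proof -
  obtain A B where "f = wseries \<kappa> (dcoeff A)" "bounded (\<rho> + \<epsilon>) A"
    "g = wseries \<kappa> (dcoeff B)" "bounded (\<rho> + \<epsilon>) B"
    using assms by (auto simp: Dser_def)
  then show ?thesis using bounded_add[of "\<rho> + \<epsilon>" A B]
    by (auto simp: Dser_def wseries_add simp flip: dcoeff_add)
qed

lemma Sser_scale: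
  assumes "x \<in> K" "ereal t \<le> v x" "f \<in> Sser \<rho>" shows "scale x f \<in> Sser (t + \<rho>)"
  using assms bounded_scale[OF assms(1,2)] by (auto simp: Sser_def wseries_scale)

lemma Rser_scale:
  assumes "x \<in> K" "ereal t \<le> v x" "f \<in> Rser \<rho>" shows "scale x f \<in> Rser (t + \<rho>)"
proof -
  obtain A where "f = wseries \<kappa> A" "bounded \<rho> A" "\<forall>n m. A n (Suc m) = 0"
    using assms by (auto simp: Rser_def)
  then show ?thesis using bounded_scale[OF assms(1,2)]
    by (auto simp: Rser_def wseries_scale intro!: exI[of _ "\<lambda>n m. x * A n m"])
qed

lemma Dser_scale:
  assumes "x \<in> K" "ereal t \<le> v x" "f \<in> Dser \<rho>" shows "scale x f \<in> Dser (t + \<rho>)"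
proof -
  obtain A where "f = wseries \<kappa> (dcoeff A)" "bounded (\<rho> + \<epsilon>) A"
    using assms by (auto simp: Dser_def)
  then show ?thesis using bounded_scale[OF assms(1,2), of "\<rho> + \<epsilon>" A]
    by (auto simp: Dser_def wseries_scale add.assoc simp flip: dcoeff_scale)
qed

lemma Rser_subset_Sser: "Rser \<rho> \<subseteq> Sser \<rho>"
  by (auto simp: Rser_def Sser_def)

lemma Dser_subset_Sser: "Dser \<rho> \<subseteq> Sser \<rho>"
  using bounded_dcoeff by (auto simp: Dser_def Sser_def)

lemma Sser_decomp:
  assumes "h \<in> Sser \<rho>"
  obtains f g where "f \<in> Rser \<rho>" "g \<in> Dser \<rho>" "h = f + g"
proof -
  obtain B where B: "h = wseries \<kappa> B" "bounded \<rho> B" using assms by (auto simp: Sser_def)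
  obtain A where A: "bounded (\<rho> + \<epsilon>) A" "\<And>n m. dcoeff A n (Suc m) = B n (Suc m)"
    using dcoeff_solvable[OF B(2)] by blast
  have "h = wseries \<kappa> (\<lambda>n m. B n m - dcoeff A n m) + wseries \<kappa> (dcoeff A)"
    by (simp add: wseries_add B(1))
  moreover have "bounded \<rho> (\<lambda>n m. B n m - dcoeff A n m)"
    using bounded_diff B(2) bounded_dcoeff[OF A(1)] by blast
  then have "wseries \<kappa> (\<lambda>n m. B n m - dcoeff A n m) \<in> Rser \<rho>"
    using A(2) unfolding Rser_def by force
  moreover have "wseries \<kappa> (dcoeff A) \<in> Dser \<rho>" using A(1) by (auto simp: Dser_def)
  ultimately show thesis using that by blast
qed

text \<open>Independent \<open>\<rho>\<close> and \<open>\<sigma>\<close> let this serve for the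
  unions too.\<close>

lemma Rser_Dser_disjoint:
  assumes "f \<in> Rser \<rho>" "f \<in> Dser \<sigma>" shows "f = 0"
proof -
  obtain B where B: "f = wseries \<kappa> B" "\<And>n m. B n (Suc m) = 0"
    using assms(1) by (auto simp: Rser_def)
  obtain A where A: "f = wseries \<kappa> (dcoeff A)" "bounded (\<sigma> + \<epsilon>) A"
    using assms(2) by (auto simp: Dser_def)
  from A B have "B = dcoeff A" by (simp add: wseries_eq_iff)
  then have "A n m = 0" for n m using dcoeff_injective[OF A(2)] B(2) by simp
  then have "A = (\<lambda>n m. 0)" by (simp add: fun_eq_iff)
  then show ?thesis using A(1) by (simp add: dcoeff_0 wseries_0)
qed

text \<open>Scaling by an element of order at least \<open>t\<close> moves the bound by
  \<open>t\<close>, so a fixed \<open>\<rho>\<close> is preserved by integral scalars.\<close>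

lemma direct_sum_Sser: "internal_direct_sum {x \<in> K. 0 \<le> v x} (Sser \<rho>) (Rser \<rho>) (Dser \<rho>)"
proof -
  have "is_submodule {x \<in> K. 0 \<le> v x} (Sser \<rho>)" "is_submodule {x \<in> K. 0 \<le> v x} (Rser \<rho>)"
    "is_submodule {x \<in> K. 0 \<le> v x} (Dser \<rho>)"
    using Sser_scale[of _ 0 _ \<rho>] Rser_scale[of _ 0 _ \<rho>] Dser_scale[of _ 0 _ \<rho>]
    by (auto simp: is_submodule_def Sser_0 Rser_0 Dser_0 Sser_add Rser_add Dser_add zero_ereal_def)
  moreover have "Sser \<rho> = {f + g | f g. f \<in> Rser \<rho> \<and> g \<in> Dser \<rho>}"
  proof (intro Set.set_eqI iffI)
    fix h assume "h \<in> Sser \<rho>"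
    then show "h \<in> {f + g | f g. f \<in> Rser \<rho> \<and> g \<in> Dser \<rho>}" by (rule Sser_decomp) blast
  qed (use Rser_subset_Sser Dser_subset_Sser Sser_add in blast)
  moreover have "Rser \<rho> \<inter> Dser \<rho> = {0}"
    using Rser_Dser_disjoint Rser_0 Dser_0 by blast
  ultimately show ?thesis by (simp add: internal_direct_sum_def)
qed

text \<open>The families decrease in \<open>\<rho>\<close>, so two elements share a member; a scalar
  of negative order merely moves to another member.\<close>

lemma is_submodule_UNION:
  assumes mono: "\<And>\<rho> \<sigma>. \<sigma> \<le> \<rho> \<Longrightarrow> F \<rho> \<subseteq> F \<sigma>" and zero: "\<And>\<rho>. 0 \<in> F \<rho>"
    and add: "\<And>f g \<rho>. f \<in> F \<rho> \<Longrightarrow> g \<in> F \<rho> \<Longrightarrow> f + g \<in> F \<rho>"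
    and scale: "\<And>x t f \<rho>. x \<in> K \<Longrightarrow> ereal t \<le> v x \<Longrightarrow> f \<in> F \<rho> \<Longrightarrow> scale x f \<in> F (t + \<rho>)"
  shows "is_submodule K (\<Union>\<rho>::real. F \<rho>)"
  unfolding is_submodule_def
proof (intro conjI ballI)
  show "0 \<in> (\<Union>\<rho>. F \<rho>)" using zero by blast
next
  fix f g assume "f \<in> (\<Union>\<rho>. F \<rho>)" "g \<in> (\<Union>\<rho>. F \<rho>)"
  then obtain \<rho> \<sigma> where "f \<in> F \<rho>" "g \<in> F \<sigma>" by blast
  then have "f \<in> F (min \<rho> \<sigma>)" "g \<in> F (min \<rho> \<sigma>)"
    using mono[of "min \<rho> \<sigma>"] by (meson min.cobounded1 min.cobounded2 subsetD)+
  then show "f + g \<in> (\<Union>\<rho>. F \<rho>)" using add by blast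
next
  fix x f assume x: "x \<in> K" and "f \<in> (\<Union>\<rho>. F \<rho>)"
  then obtain \<rho> where f: "f \<in> F \<rho>" by blast
  obtain t where "ereal t \<le> v x"
  proof (cases "x = 0")
    case False
    then show ?thesis using that v_finite[OF x] by (metis order_refl)
  qed (use that in simp)
  then show "scale x f \<in> (\<Union>\<rho>. F \<rho>)" using scale[OF x _ f] by blast
qed

lemma del_Sser_UNION: "del \<pi> \<kappa> ` (\<Union>\<rho>. Sser \<rho>) = (\<Union>\<rho>. Dser \<rho>)"
proof -
  have "(\<Union>\<rho>. Sser \<rho>) = (\<Union>\<rho>. Sser (\<rho> + \<epsilon>))"
  proof (intro equalityI UN_least)
    fix \<rho>
    show "Sser \<rho> \<subseteq> (\<Union>\<rho>. Sser (\<rho> + \<epsilon>))"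
      using UN_upper[of "\<rho> - \<epsilon>" UNIV "\<lambda>\<rho>. Sser (\<rho> + \<epsilon>)"] by simp
  qed blast
  then show ?thesis by (simp add: image_UN del_Sser)
qed

lemma direct_sum_Sser_UNION:
  "internal_direct_sum K (\<Union>\<rho>. Sser \<rho>) (\<Union>\<rho>. Rser \<rho>) (\<Union>\<rho>. Dser \<rho>)"
proof -
  have S: "is_submodule K (\<Union>\<rho>. Sser \<rho>)"
    using Sser_mono Sser_0 Sser_add Sser_scale by (rule is_submodule_UNION)
  have R: "is_submodule K (\<Union>\<rho>. Rser \<rho>)"
    using Rser_mono Rser_0 Rser_add Rser_scale by (rule is_submodule_UNION)
  have D: "is_submodule K (\<Union>\<rho>. Dser \<rho>)"
    using Dser_mono Dser_0 Dser_add Dser_scale by (rule is_submodule_UNION)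
  have "(\<Union>\<rho>. Sser \<rho>) = {f + g | f g. f \<in> (\<Union>\<rho>. Rser \<rho>) \<and> g \<in> (\<Union>\<rho>. Dser \<rho>)}"
  proof (intro Set.set_eqI iffI)
    fix h assume "h \<in> (\<Union>\<rho>. Sser \<rho>)"
    then obtain \<rho> where "h \<in> Sser \<rho>" by blast
    then show "h \<in> {f + g | f g. f \<in> (\<Union>\<rho>. Rser \<rho>) \<and> g \<in> (\<Union>\<rho>. Dser \<rho>)}"
      by (rule Sser_decomp) blast
  next
    fix h assume "h \<in> {f + g | f g. f \<in> (\<Union>\<rho>. Rser \<rho>) \<and> g \<in> (\<Union>\<rho>. Dser \<rho>)}"
    then obtain f g where h: "h = f + g" and "f \<in> (\<Union>\<rho>. Rser \<rho>)" "g \<in> (\<Union>\<rho>. Dser \<rho>)" by blast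
    then have "f \<in> (\<Union>\<rho>. Sser \<rho>)" "g \<in> (\<Union>\<rho>. Sser \<rho>)"
      using Rser_subset_Sser Dser_subset_Sser by blast+
    then show "h \<in> (\<Union>\<rho>. Sser \<rho>)" using S h unfolding is_submodule_def by blast
  qed
  moreover have "(\<Union>\<rho>. Rser \<rho>) \<inter> (\<Union>\<rho>. Dser \<rho>) = {0}"
    using Rser_Dser_disjoint Rser_0 Dser_0 by blast
  ultimately show ?thesis using S R D by (simp add: internal_direct_sum_def)
qed

end

theorem theorem3p4:
  fixes \<pi> \<kappa> :: "'p::prime_card qp_bar" and p :: nat and b b' \<epsilon> :: real
  assumes "p = CARD('p)" and "p \<ge> 5"
    and "\<pi> ^ (p - 1) = - of_nat p"
    and "b \<le> (real p - 1) / real p" and "b > 1 / (real p - 1)"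
    and "b' \<le> b" and "\<epsilon> = b - 1 / (real p - 1)"
    and "\<kappa> \<in> Zp - \<nat>"
  shows "internal_direct_sum (Omega_int \<pi>)
           (S_space \<pi> \<kappa> b' \<epsilon> 0) (R_space \<pi> b' 0) (del \<pi> \<kappa> ` S_space \<pi> \<kappa> b' \<epsilon> \<epsilon>) \<and>
         quotient_iso (Omega \<pi>)
           (S_union \<pi> \<kappa> b' \<epsilon>) (del \<pi> \<kappa> ` S_union \<pi> \<kappa> b' \<epsilon>) (R_union \<pi> b')
           (add_coset (del \<pi> \<kappa> ` S_union \<pi> \<kappa> b' \<epsilon>))"
proof -
  interpret eisenstein_root \<pi> "p - 1"
    using assms by unfold_locales auto
  interpret Om: complete_valued_subring "Omega \<pi>" "ord_ext (Omega \<pi>)"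
    by (rule complete_valued_Omega)
  obtain z :: "'p padic_int" where z: "\<kappa> = to_ac (qp_of_int z)"
    using assms(8) by (auto simp: Zp_def qp_of_int_def)
  have e: "real (p - 1) = real p - 1" using assms(2) by simp
  \<comment> \<open>With \<open>c = 1 / (p - 1)\<close> one has \<open>\<epsilon> + c = b\<close>:
    \<open>b'_le\<close> is the hypothesis \<open>b' \<le> b\<close>, and \<open>eps_pos\<close> is
    the lower bound on \<open>b\<close>.\<close>
  interpret dwork_series "Omega \<pi>" "ord_ext (Omega \<pi>)" \<pi> \<kappa> "1 / (real p - 1)" b' \<epsilon>
  proof
    show "ord_ext (Omega \<pi>) \<pi> = ereal (1 / (real p - 1))" using ord_ext_pi e by simp
    show "0 \<le> ord_ext (Omega \<pi>) \<kappa>" unfolding z ord_ext_to_ac ord_qp_ge_0_iff by blast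
    show "\<kappa> \<in> Omega \<pi>" unfolding z by (rule to_ac_in_Omega)
  qed (use assms pi_in_Omega in auto)
  have S: "S_space \<pi> \<kappa> b' \<epsilon> = Sser"
    by (auto simp: fun_eq_iff S_space_def Sser_def bounded_def)
  have R: "R_space \<pi> b' = Rser"
  proof (intro ext Set.set_eqI iffI)
    fix \<rho> f assume "f \<in> R_space \<pi> b' \<rho>"
    then obtain a where a: "f = Abs_fps (\<lambda>n. fps_const (a n))"
      "\<And>n. a n \<in> Omega \<pi>" "\<And>n. ereal (2 * b' * real n + \<rho>) \<le> ord_ext (Omega \<pi>) (a n)"
      by (auto simp: R_space_def)
    have "f = wseries \<kappa> (\<lambda>n m. if m = 0 then a n else 0)"
      by (simp add: a(1) fps_eq_iff falling_def)
    moreover have "bounded \<rho> (\<lambda>n m. if m = 0 then a n else 0)"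
      using a(2,3) by (simp add: bounded_def)
    ultimately show "f \<in> Rser \<rho>" unfolding Rser_def by force
  next
    fix \<rho> f assume "f \<in> Rser \<rho>"
    then obtain A where A: "f = wseries \<kappa> A" "bounded \<rho> A" "\<And>n m. A n (Suc m) = 0"
      by (auto simp: Rser_def)
    have "A n m * falling \<kappa> m = (if m = 0 then A n 0 else 0)" for n m
      using A(3) by (cases m) (auto simp: falling_def)
    then have "f = Abs_fps (\<lambda>n. fps_const (A n 0))"
      by (simp add: A(1) fps_eq_iff)
    moreover have "A n 0 \<in> Omega \<pi> \<and> ereal (2 * b' * real n + \<rho>) \<le> ord_ext (Omega \<pi>) (A n 0)" for n
      using boundedD[OF A(2), of n 0] by simp
    ultimately show "f \<in> R_space \<pi> b' \<rho>"
      unfolding R_space_def by (intro CollectI exI[of _ "\<lambda>n. A n 0"]) blast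
  qed
  have "internal_direct_sum (Omega_int \<pi>)
           (S_space \<pi> \<kappa> b' \<epsilon> 0) (R_space \<pi> b' 0) (del \<pi> \<kappa> ` S_space \<pi> \<kappa> b' \<epsilon> \<epsilon>)"
    using direct_sum_Sser[of 0] del_Sser[of 0] by (simp add: S R Omega_int_def)
  moreover have "quotient_iso (Omega \<pi>)
           (S_union \<pi> \<kappa> b' \<epsilon>) (del \<pi> \<kappa> ` S_union \<pi> \<kappa> b' \<epsilon>) (R_union \<pi> b')
           (add_coset (del \<pi> \<kappa> ` S_union \<pi> \<kappa> b' \<epsilon>))"
    unfolding S_union_def R_union_def S R del_Sser_UNION
    by (rule internal_direct_sum_imp_quotient_iso[OF direct_sum_Sser_UNION]) simp
  ultimately show ?thesis by blast
qed

end
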